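(* Let $m,p,n\ge1$ be integers with $p\mid m$. The reduced Gröbner basis of $\mathcal{I}_{G(m, p, n)}$ with respect to the lexicographic term order with $x_1 > \cdots > x_n$ is: (i) if $p=1$: $\{h_j(x_j^m, \ldots, x_n^m) : j \in \{1,\dots,n\}\}$; (ii) if $p>1$: $\{h_j(x_j^m, \ldots, x_n^m) : j \in \{1,\dots,n-1\}\} \sqcup \{h_{j-1}(x_j^m, \ldots, x_n^m)\, (x_j \cdots x_n)^{m/p} : j \in \{1,\dots,n\}\}$.
   Context: $K \subset \mathbb{C}$ is a subfield closed under complex conjugation containing the $m$th roots of unity. $G(m,p,n)$ is the group of $n\times n$ matrices over $K$ with exactly one non-zero entry in each row and column, each such entry an $m$th root of unity, such that the product of the non-zero entries raised to the power $m/p$ is $1$. It acts on $K[x_1,\dots,x_n]$, where $x_1,\dots,x_n$ are the coordinate functions on $K^n$, by $(\sigma\cdot f)(v)=f(\sigma^{-1}v)$. $\mathcal{I}_{G}$ is the ideal of $K[x_1,\dots,x_n]$ generated by all homogeneous $G$-invariant polynomials of positive degree. $h_j(y_1,\dots,y_s)$ is the complete homogeneous symmetric polynomial of degree $j$ (with $h_0=1$). A Gröbner basis $\mathcal{G}$ is reduced if every $g\in\mathcal{G}$ has leading coefficient $1$ and the leading monomial of $g$ divides no monomial occurring in any $h\in\mathcal{G}\setminus\{g\}$. *)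

theory Defs
  imports
    Complex_Main
    "HOL-Library.Poly_Mapping"
    "HOL-Library.Multiset"
    "HOL-Algebra.Ideal"
    "HOL-Algebra.Subrings"
    "Jordan_Normal_Form.Matrix"
    "Jordan_Normal_Form.VS_Connect"
begin

section \<open>Polynomials in finitely many variables over a subfield of the complex numbers\<close>

text \<open>
  A monomial is an exponent vector \<^typ>\<open>nat \<Rightarrow>\<^sub>0 nat\<close>, and a polynomial is a finitely supported map from
  monomials to coefficients; multiplication is the convolution product of \<^theory>\<open>HOL-Library.Poly_Mapping\<close>.
  The variables \<open>x\<^sub>1, \<dots>, x\<^sub>n\<close> carry the indices \<open>1, \<dots>, n\<close>.
\<close>

type_synonym monom = "nat \<Rightarrow>\<^sub>0 nat"
type_synonym mpoly = "monom \<Rightarrow>\<^sub>0 complex"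

definition var :: "nat \<Rightarrow> mpoly" where
  "var i = Poly_Mapping.single (Poly_Mapping.single i 1) 1"

definition mpolys :: "complex set \<Rightarrow> nat \<Rightarrow> mpoly set" where
  "mpolys K n = {f. \<forall>a \<in> Poly_Mapping.keys f.
     Poly_Mapping.lookup f a \<in> K \<and> Poly_Mapping.keys a \<subseteq> {1..n}}"

definition mpoly_ring :: "complex set \<Rightarrow> nat \<Rightarrow> mpoly ring" where
  "mpoly_ring K n = class_ring\<lparr>carrier := mpolys K n\<rparr>"

lemma cring_mpoly_ring:
  assumes "subfield K (class_ring :: complex ring)"
  shows "cring (mpoly_ring K n)"
proof -
  interpret K: subfield K "class_ring :: complex ring" by fact
  have grp: "subgroup K (add_monoid (class_ring :: complex ring))"
    and mon: "submonoid K (class_ring :: complex ring)"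
    by (rule K.subgroup_axioms, rule K.submonoid_axioms)
  have K0: "0 \<in> K" using subgroup.one_closed[OF grp] by simp
  have K1: "1 \<in> K" using submonoid.one_closed[OF mon] by simp
  have Ka: "x + y \<in> K" if "x \<in> K" "y \<in> K" for x y
    using subgroup.m_closed[OF grp that] by simp
  have Km: "x * y \<in> K" if "x \<in> K" "y \<in> K" for x y
    using submonoid.m_closed[OF mon that] by simp
  have inv_class: "inv\<^bsub>add_monoid (class_ring :: complex ring)\<^esub> x = - x" for x
    unfolding m_inv_def by (rule the_equality) (simp_all add: eq_neg_iff_add_eq_0)
  have Ku: "- x \<in> K" if "x \<in> K" for x
    using subgroup.m_inv_closed[OF grp that] inv_class by simp
  let ?P = "mpolys K n"
  have P_alt: "f \<in> ?P \<longleftrightarrow> (\<forall>a. Poly_Mapping.lookup f a \<in> K) \<and>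
      (\<forall>a \<in> Poly_Mapping.keys f. Poly_Mapping.keys a \<subseteq> {1..n})" for f
    unfolding mpolys_def mem_Collect_eq by (metis K0 in_keys_iff)
  have P0: "0 \<in> ?P" by (simp add: mpolys_def)
  have P1: "1 \<in> ?P" using K1 by (simp add: mpolys_def lookup_one)
  have Pa: "f + g \<in> ?P" if "f \<in> ?P" "g \<in> ?P" for f g
    using that Poly_Mapping.keys_add[of f g] unfolding P_alt lookup_add by (blast intro: Ka)
  have Pu: "- f \<in> ?P" if "f \<in> ?P" for f
    using that Ku unfolding P_alt by auto
  have Pm: "f * g \<in> ?P" if fg: "f \<in> ?P" "g \<in> ?P" for f g
    unfolding P_alt
  proof (intro conjI allI ballI)
    fix a
    have sum_K: "(\<Sum>x\<in>X. h x) \<in> K" if "\<And>x. x \<in> X \<Longrightarrow> h x \<in> K" for X :: "monom set" and h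
      using that by (induction X rule: infinite_finite_induct) (auto simp: K0 Ka)
    have Sum_any_K: "(Sum_any h) \<in> K" if "\<And>x. h x \<in> K" for h :: "monom \<Rightarrow> complex"
      unfolding Sum_any.expand_set by (rule sum_K) (rule that)
    show "Poly_Mapping.lookup (f * g) a \<in> K"
      unfolding lookup_mult using fg K0 unfolding P_alt
      by (intro Sum_any_K Km) (auto simp: when_def)
  next
    fix a assume "a \<in> Poly_Mapping.keys (f * g)"
    then obtain b c where bc: "b \<in> Poly_Mapping.keys f" "c \<in> Poly_Mapping.keys g" "a = b + c"
      using keys_mult[of f g] by blast
    then have "Poly_Mapping.keys b \<subseteq> {1..n}" "Poly_Mapping.keys c \<subseteq> {1..n}"
      using fg by (auto simp: P_alt)
    then show "Poly_Mapping.keys a \<subseteq> {1..n}"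
      using Poly_Mapping.keys_add[of b c] bc(3) by auto
  qed
  have neg: "\<exists>g \<in> ?P. f + g = 0" if "f \<in> ?P" for f
    using Pu[OF that] by (intro bexI[of _ "- f"]) simp_all
  show ?thesis
  proof (rule cringI)
    show "abelian_group (mpoly_ring K n)"
      by (rule abelian_groupI) (simp_all add: mpoly_ring_def P0 Pa neg ac_simps)
    show "comm_monoid (mpoly_ring K n)"
      by (rule comm_monoidI) (simp_all add: mpoly_ring_def P1 Pm ac_simps)
  qed (simp add: mpoly_ring_def distrib_right)
qed

definition monom_deg :: "monom \<Rightarrow> nat" where
  "monom_deg a = (\<Sum>i \<in> Poly_Mapping.keys a. Poly_Mapping.lookup a i)"

definition homogeneous :: "nat \<Rightarrow> mpoly \<Rightarrow> bool" where
  "homogeneous d f \<longleftrightarrow> (\<forall>a \<in> Poly_Mapping.keys f. monom_deg a = d)"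

text \<open>The variable \<open>x\<^sub>i\<close> is the \<open>i\<close>-th coordinate function; entries of vectors are indexed from 0.\<close>

definition mpoly_eval :: "mpoly \<Rightarrow> complex vec \<Rightarrow> complex" where
  "mpoly_eval f v = (\<Sum>a \<in> Poly_Mapping.keys f. Poly_Mapping.lookup f a *
     (\<Prod>i \<in> Poly_Mapping.keys a. (v $ (i - 1)) ^ Poly_Mapping.lookup a i))"

text \<open>
  The sum of all monomials of degree \<open>j\<close> in the \<open>y i\<close> with \<open>i \<in> S\<close>, a monomial being
  given by the multiset of its factors.
\<close>

definition complete_hom :: "nat \<Rightarrow> nat set \<Rightarrow> (nat \<Rightarrow> 'a::comm_semiring_1) \<Rightarrow> 'a" where
  "complete_hom j S y = (\<Sum>M | set_mset M \<subseteq> S \<and> size M = j. \<Prod>i\<in>#M. y i)"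

lemma finite_multisets_of_size:
  assumes "finite S"
  shows "finite {M. set_mset M \<subseteq> S \<and> size M = j}"
proof (rule finite_subset)
  show "{M. set_mset M \<subseteq> S \<and> size M = j} \<subseteq> mset ` {xs. set xs \<subseteq> S \<and> length xs = j}"
  proof
    fix M assume M: "M \<in> {M. set_mset M \<subseteq> S \<and> size M = j}"
    obtain xs where "mset xs = M" using ex_mset by blast
    then show "M \<in> mset ` {xs. set xs \<subseteq> S \<and> length xs = j}" using M by force
  qed
  show "finite (mset ` {xs. set xs \<subseteq> S \<and> length xs = j})"
    using finite_lists_length_eq[OF assms] by simp
qed


section \<open>The groups \<open>G(m,p,n)\<close> and their invariants\<close>

definition G_group :: "complex set \<Rightarrow> nat \<Rightarrow> nat \<Rightarrow> nat \<Rightarrow> complex mat set" where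
  "G_group K m p n = {A \<in> carrier_mat n n.
     elements_mat A \<subseteq> K \<and>
     (\<forall>i<n. \<exists>!j. j < n \<and> A $$ (i, j) \<noteq> 0) \<and>
     (\<forall>j<n. \<exists>!i. i < n \<and> A $$ (i, j) \<noteq> 0) \<and>
     (\<forall>i<n. \<forall>j<n. A $$ (i, j) \<noteq> 0 \<longrightarrow> A $$ (i, j) ^ m = 1) \<and>
     (\<Prod>(i, j) \<in> {(i, j). i < n \<and> j < n \<and> A $$ (i, j) \<noteq> 0}. A $$ (i, j)) ^ (m div p) = 1}"

definition act :: "nat \<Rightarrow> complex mat \<Rightarrow> (complex vec \<Rightarrow> complex) \<Rightarrow> complex vec \<Rightarrow> complex" where
  "act n \<sigma> F v = F (inv\<^bsub>ring_mat TYPE(complex) n ()\<^esub> \<sigma> *\<^sub>v v)"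

text \<open>
  A subfield of the complex numbers is infinite, so a polynomial over \<open>K\<close> is determined by the function
  it induces on \<open>K\<^sup>n\<close>; invariance \<open>\<sigma> \<cdot> f = f\<close> is therefore stated as equality of functions on \<open>K\<^sup>n\<close>.
\<close>

definition invariant :: "complex set \<Rightarrow> nat \<Rightarrow> complex mat set \<Rightarrow> mpoly \<Rightarrow> bool" where
  "invariant K n G f \<longleftrightarrow>
     (\<forall>\<sigma> \<in> G. \<forall>v \<in> carrier_vec n. set\<^sub>v v \<subseteq> K \<longrightarrow> act n \<sigma> (mpoly_eval f) v = mpoly_eval f v)"

definition invariant_ideal :: "complex set \<Rightarrow> nat \<Rightarrow> complex mat set \<Rightarrow> mpoly set" where
  "invariant_ideal K n G = Idl\<^bsub>mpoly_ring K n\<^esub>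
     {f \<in> mpolys K n. (\<exists>d>0. homogeneous d f) \<and> invariant K n G f}"


section \<open>Groebner bases for the lexicographic order\<close>

text \<open>
  The order on \<^typ>\<open>nat \<Rightarrow>\<^sub>0 nat\<close> provided by \<^theory>\<open>HOL-Library.Poly_Mapping\<close> is the
  lexicographic order with \<open>x\<^sub>1 > \<dots> > x\<^sub>n\<close>: the least index at which two exponent vectors differ decides.
\<close>

lemma monom_less_iff:
  fixes a b :: monom
  shows "a < b \<longleftrightarrow> (\<exists>i. Poly_Mapping.lookup a i < Poly_Mapping.lookup b i \<and>
    (\<forall>j<i. Poly_Mapping.lookup a j = Poly_Mapping.lookup b j))"
  by (simp add: less_poly_mapping.rep_eq less_fun_def)

text \<open>Only meaningful for \<open>f \<noteq> 0\<close>.\<close>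

definition lead_monom :: "mpoly \<Rightarrow> monom" where
  "lead_monom f = Max (Poly_Mapping.keys f)"

definition lead_coef :: "mpoly \<Rightarrow> complex" where
  "lead_coef f = Poly_Mapping.lookup f (lead_monom f)"

definition monom_dvd :: "monom \<Rightarrow> monom \<Rightarrow> bool" where
  "monom_dvd a b \<longleftrightarrow> (\<exists>c. b = a + c)"

definition initial_ideal :: "complex set \<Rightarrow> nat \<Rightarrow> mpoly set \<Rightarrow> mpoly set" where
  "initial_ideal K n F = Idl\<^bsub>mpoly_ring K n\<^esub>
     ((\<lambda>f. Poly_Mapping.single (lead_monom f) 1) ` (F - {0}))"

definition groebner_basis :: "complex set \<Rightarrow> nat \<Rightarrow> mpoly set \<Rightarrow> mpoly set \<Rightarrow> bool" where
  "groebner_basis K n I B \<longleftrightarrow>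
     finite B \<and> B \<subseteq> I \<and> initial_ideal K n B = initial_ideal K n I"

definition reduced_groebner_basis :: "complex set \<Rightarrow> nat \<Rightarrow> mpoly set \<Rightarrow> mpoly set \<Rightarrow> bool" where
  "reduced_groebner_basis K n I B \<longleftrightarrow>
     groebner_basis K n I B \<and>
     (\<forall>g \<in> B. lead_coef g = 1 \<and>
        (\<forall>h \<in> B - {g}. \<forall>a \<in> Poly_Mapping.keys h. \<not> monom_dvd (lead_monom g) a))"

end

theory Submission
  imports
    Defs
    "HOL-Combinatorics.Permutations"
    "HOL-Computational_Algebra.Polynomial"
begin

text \<open>
  Write \<open>q = m/p\<close> and \<open>y\<^sub>i = x\<^sub>i\<^sup>m\<close>. Three things have to be shown: the listed polynomials lie in the ideal
  \<open>I\<close>; the lead monomial of every non-zero element of \<open>I\<close> is divisible by one of theirs; and they are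
  reduced. The last part is a comparison of exponents, and uniqueness of reduced Groebner bases
  (\<open>reduced_groebner_basis_unique\<close>) then gives the equivalence.

  Membership comes from \<open>h\<^sub>k(y\<^bsub>j+1\<^esub>, \<dots>, y\<^sub>n) = h\<^sub>k(y\<^sub>j, \<dots>, y\<^sub>n) - y\<^sub>j h\<^bsub>k-1\<^esub>(y\<^sub>j, \<dots>, y\<^sub>n)\<close>, by which one
  descends from the invariants \<open>h\<^sub>k(y\<^sub>1, \<dots>, y\<^sub>n)\<close> and \<open>(x\<^sub>1 \<cdots> x\<^sub>n)\<^sup>q\<close>
  (\<open>gen_0_in_invariant_ideal\<close>, \<open>gen_q_in_invariant_ideal\<close>).

  For the lead monomials, a linear functional detects non-membership in \<open>I\<close>. Let \<open>\<phi>(g)\<close> be the sum over all permutations \<open>s\<close> of \<open>sign s\<close> times the coefficient in \<open>g\<close> of the monomial with exponents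
  \<open>m (s(i) - 1) + q - 1\<close>. If \<open>f\<close> is an invariant without constant term, then \<open>\<phi>(x\<^sup>b f) = 0\<close> for every \<open>b\<close>:
  the coefficients of \<open>f\<close> are symmetric and live on exponents that are congruent to each other modulo \<open>m\<close>
  and divisible by \<open>q\<close>; two equal entries of \<open>b\<close> cancel the sum in pairs, and distinct entries leave room only
  for the constant term of \<open>f\<close> (\<open>alt_coeff_monom_times_invariant\<close>). So \<open>\<phi>\<close> vanishes on \<open>I\<close>. On the other hand, if the
  lead monomial \<open>x\<^sup>a\<close> of \<open>f\<close> is divisible by none of the listed lead monomials, then \<open>x\<^sup>a\<close> divides one of the
  monomials in \<open>\<phi>\<close>, and multiplying \<open>f\<close> by the quotient \<open>x\<^sup>b\<close> brings no other of them into play. So \<open>\<phi>(x\<^sup>b f)\<close> is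
  the lead coefficient of \<open>f\<close> up to sign, and \<open>f \<notin> I\<close> (\<open>invariant_ideal_lead_monom\<close>).
\<close>

section \<open>Exponent vectors and their divisibility order\<close>

definition expvec :: "nat set \<Rightarrow> (nat \<Rightarrow> nat) \<Rightarrow> monom" where
  "expvec S f = (\<Sum>i\<in>S. Poly_Mapping.single i (f i))"

lemma lookup_expvec:
  assumes "finite S"
  shows "Poly_Mapping.lookup (expvec S f) i = (if i \<in> S then f i else 0)"
  using assms by (simp add: expvec_def lookup_sum lookup_single when_def)

lemma monom_dvd_iff:
  "monom_dvd a b \<longleftrightarrow> (\<forall>i. Poly_Mapping.lookup a i \<le> Poly_Mapping.lookup b i)"
proof
  show "monom_dvd a b" if "\<forall>i. Poly_Mapping.lookup a i \<le> Poly_Mapping.lookup b i"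
    unfolding monom_dvd_def
    by (rule exI[of _ "b - a"]) (use that in \<open>auto intro!: poly_mapping_eqI simp: lookup_add lookup_minus\<close>)
qed (auto simp: monom_dvd_def lookup_add)

lemma monom_dvd_refl: "monom_dvd a a"
  by (simp add: monom_dvd_iff)

lemma monom_dvd_trans: "monom_dvd a b \<Longrightarrow> monom_dvd b c \<Longrightarrow> monom_dvd a c"
  by (auto simp: monom_dvd_iff intro: order_trans)

lemma monom_dvd_imp_le:
  assumes "monom_dvd a b"
  shows "a \<le> b"
  using assms
  by (metis monom_dvd_def monom_less_iff lookup_add le_add1 linorder_not_less)

lemma monom_dvd_antisym: "monom_dvd a b \<Longrightarrow> monom_dvd b a \<Longrightarrow> a = b"
  by (meson monom_dvd_imp_le order_antisym)

lemma lookup_single_times: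
  fixes f :: mpoly
  shows "Poly_Mapping.lookup (Poly_Mapping.single b 1 * f) c =
    (if monom_dvd b c then Poly_Mapping.lookup f (c - b) else 0)"
proof -
  have "Poly_Mapping.lookup (Poly_Mapping.single b 1 * f) c =
      (\<Sum>d. Poly_Mapping.lookup f d when c = b + d)"
    unfolding lookup_mult lookup_single by (simp add: when_mult)
  also have "\<dots> = (if monom_dvd b c then Poly_Mapping.lookup f (c - b) else 0)"
  proof (cases "monom_dvd b c")
    case True
    then have "c = b + d \<longleftrightarrow> d = c - b" for d
      by (auto simp: monom_dvd_def)
    then show ?thesis using True by simp
  next
    case False
    then have "c \<noteq> b + d" for d
      by (auto simp: monom_dvd_def)
    then show ?thesis using False by simp
  qed
  finally show ?thesis .
qed

text \<open>
  The scalars \<open>single 0 c\<close> are split off because the functional used below commutes with them.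
\<close>

lemma mpoly_eq_sum_single:
  fixes f :: mpoly
  shows "f = (\<Sum>a\<in>Poly_Mapping.keys f. Poly_Mapping.single 0 (Poly_Mapping.lookup f a) * Poly_Mapping.single a 1)"
  by (rule poly_mapping_eqI) (auto simp: lookup_sum mult_single lookup_single when_def in_keys_iff)

lemma var_power: "var i ^ k = Poly_Mapping.single (Poly_Mapping.single i k) 1"
  by (induction k) (auto simp: var_def mult_single single_add[symmetric])

section \<open>Lead monomials\<close>

lemma lead_monom_in_keys: "f \<noteq> 0 \<Longrightarrow> lead_monom f \<in> Poly_Mapping.keys f"
  by (simp add: lead_monom_def)

lemma le_lead_monom: "a \<in> Poly_Mapping.keys f \<Longrightarrow> a \<le> lead_monom f"
  by (simp add: lead_monom_def)

lemma lead_monom_eqI: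
  assumes "a \<in> Poly_Mapping.keys f" "\<And>b. b \<in> Poly_Mapping.keys f \<Longrightarrow> b \<le> a"
  shows "lead_monom f = a"
  unfolding lead_monom_def using assms by (intro Max_eqI) auto

section \<open>Ideals of the polynomial ring\<close>

context
  fixes K :: "complex set" and n :: nat
  assumes K: "subfield K (class_ring :: complex ring)"
begin

interpretation P: cring "mpoly_ring K n"
  by (rule cring_mpoly_ring[OF K])

lemma mpolys_zero: "0 \<in> mpolys K n"
  and mpolys_one: "1 \<in> mpolys K n"
  using P.zero_closed P.one_closed by (simp_all add: mpoly_ring_def)

lemma mpolys_add: "f \<in> mpolys K n \<Longrightarrow> g \<in> mpolys K n \<Longrightarrow> f + g \<in> mpolys K n"
  and mpolys_mult: "f \<in> mpolys K n \<Longrightarrow> g \<in> mpolys K n \<Longrightarrow> f * g \<in> mpolys K n"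
  using P.a_closed[of f g] P.m_closed[of f g] by (simp_all add: mpoly_ring_def)

lemma mpolys_uminus:
  assumes "f \<in> mpolys K n"
  shows "- f \<in> mpolys K n"
proof -
  have f: "f \<in> carrier (mpoly_ring K n)" using assms by (simp add: mpoly_ring_def)
  from P.a_inv_closed[OF f] P.r_neg[OF f]
  show ?thesis by (simp add: mpoly_ring_def) (metis add_eq_0_iff)
qed

lemma mpolys_power: "f \<in> mpolys K n \<Longrightarrow> f ^ k \<in> mpolys K n"
  by (induction k) (auto intro: mpolys_one mpolys_mult)

lemma mpolys_prod: "(\<And>i. i \<in> S \<Longrightarrow> f i \<in> mpolys K n) \<Longrightarrow> prod f S \<in> mpolys K n"
  by (induction S rule: infinite_finite_induct) (auto intro: mpolys_one mpolys_mult)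

lemma mpolys_sum: "(\<And>i. i \<in> S \<Longrightarrow> f i \<in> mpolys K n) \<Longrightarrow> sum f S \<in> mpolys K n"
  by (induction S rule: infinite_finite_induct) (auto intro: mpolys_zero mpolys_add)

lemma subfield_zero: "0 \<in> K" and subfield_one: "1 \<in> K"
proof -
  interpret K: subfield K "class_ring :: complex ring" by (rule K)
  show "0 \<in> K" using subgroup.one_closed[OF K.subgroup_axioms] by simp
  show "1 \<in> K" using submonoid.one_closed[OF K.submonoid_axioms] by simp
qed

lemma subfield_add: "x \<in> K \<Longrightarrow> y \<in> K \<Longrightarrow> x + y \<in> K"
  and subfield_mult: "x \<in> K \<Longrightarrow> y \<in> K \<Longrightarrow> x * y \<in> K"
proof -
  interpret K: subfield K "class_ring :: complex ring" by (rule K)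
  show "x \<in> K \<Longrightarrow> y \<in> K \<Longrightarrow> x + y \<in> K" using subgroup.m_closed[OF K.subgroup_axioms] by simp
  show "x \<in> K \<Longrightarrow> y \<in> K \<Longrightarrow> x * y \<in> K" using submonoid.m_closed[OF K.submonoid_axioms] by simp
qed

lemma subfield_of_nat: "of_nat k \<in> K"
  by (induction k) (auto intro: subfield_zero subfield_one subfield_add)

lemma mpolys_single: "c \<in> K \<Longrightarrow> Poly_Mapping.keys a \<subseteq> {1..n} \<Longrightarrow> Poly_Mapping.single a c \<in> mpolys K n"
  by (simp add: mpolys_def)

lemma mpolys_var: "i \<in> {1..n} \<Longrightarrow> var i \<in> mpolys K n"
  unfolding var_def by (rule mpolys_single) (auto simp: subfield_one)

lemma ideal_mpoly_ringI:
  assumes "J \<subseteq> mpolys K n" "0 \<in> J" "\<And>f g. f \<in> J \<Longrightarrow> g \<in> J \<Longrightarrow> f + g \<in> J"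
    "\<And>f g. f \<in> J \<Longrightarrow> g \<in> mpolys K n \<Longrightarrow> g * f \<in> J"
  shows "ideal J (mpoly_ring K n)"
proof (rule idealI)
  have inv: "m_inv (add_monoid (mpoly_ring K n)) f = - 1 * f" if "f \<in> J" for f
  proof -
    have "f \<in> mpolys K n" "- f \<in> mpolys K n" using that assms(1) mpolys_uminus by auto
    then show ?thesis
      unfolding m_inv_def
      by (intro the_equality) (auto simp: mpoly_ring_def eq_neg_iff_add_eq_0)
  qed
  have neg: "- f \<in> J" if "f \<in> J" for f
    using assms(4)[OF that mpolys_uminus[OF mpolys_one]] by simp
  show "subgroup J (add_monoid (mpoly_ring K n))"
    by (rule subgroup.intro) (use assms inv neg in \<open>auto simp: mpoly_ring_def\<close>)
  show "ring (mpoly_ring K n)" by (rule P.ring_axioms)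
qed (use assms in \<open>auto simp: mpoly_ring_def mult.commute\<close>)

lemma ideal_mpoly_ringD:
  assumes "ideal J (mpoly_ring K n)"
  shows "J \<subseteq> mpolys K n" "0 \<in> J" "\<And>f g. f \<in> J \<Longrightarrow> g \<in> J \<Longrightarrow> f + g \<in> J"
    "\<And>f g. f \<in> J \<Longrightarrow> g \<in> mpolys K n \<Longrightarrow> g * f \<in> J"
    "\<And>f g. f \<in> J \<Longrightarrow> g \<in> J \<Longrightarrow> f - g \<in> J"
proof -
  interpret J: ideal J "mpoly_ring K n" by (rule assms)
  show "J \<subseteq> mpolys K n" using J.a_subset by (simp add: mpoly_ring_def)
  show "0 \<in> J" using J.zero_closed by (simp add: mpoly_ring_def)
  show add: "f \<in> J \<Longrightarrow> g \<in> J \<Longrightarrow> f + g \<in> J" for f g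
    using J.a_closed[of f g] by (simp add: mpoly_ring_def)
  show mult: "f \<in> J \<Longrightarrow> g \<in> mpolys K n \<Longrightarrow> g * f \<in> J" for f g
    using J.I_l_closed[of f g] by (simp add: mpoly_ring_def)
  show "f \<in> J \<Longrightarrow> g \<in> J \<Longrightarrow> f - g \<in> J" for f g
    using add[of f "- g"] mult[OF _ mpolys_uminus[OF mpolys_one], of g] by simp
qed

lemma ideal_Idl:
  assumes "S \<subseteq> mpolys K n"
  shows "ideal (Idl\<^bsub>mpoly_ring K n\<^esub> S) (mpoly_ring K n)"
  by (rule P.genideal_ideal) (use assms in \<open>simp add: mpoly_ring_def\<close>)

lemma Idl_self:
  assumes "S \<subseteq> mpolys K n"
  shows "S \<subseteq> Idl\<^bsub>mpoly_ring K n\<^esub> S"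
  by (rule P.genideal_self) (use assms in \<open>simp add: mpoly_ring_def\<close>)

lemma Idl_minimal: "ideal J (mpoly_ring K n) \<Longrightarrow> S \<subseteq> J \<Longrightarrow> Idl\<^bsub>mpoly_ring K n\<^esub> S \<subseteq> J"
  by (rule P.genideal_minimal)

end

section \<open>Reduced Groebner bases are unique\<close>

context
  fixes K :: "complex set" and n :: nat
  assumes K: "subfield K (class_ring :: complex ring)"
begin

text \<open>
  The polynomials all of whose monomials are multiples of elements of \<open>S\<close> form an ideal that
  contains the generators, hence the ideal generated by \<open>S\<close>.
\<close>

lemma monom_ideal_dvd:
  assumes "S \<subseteq> {a. Poly_Mapping.keys a \<subseteq> {1..n}}"
    and "Poly_Mapping.single b 1 \<in> Idl\<^bsub>mpoly_ring K n\<^esub> ((\<lambda>a. Poly_Mapping.single a 1) ` S)"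
  shows "\<exists>a\<in>S. monom_dvd a b"
proof -
  let ?J = "{f \<in> mpolys K n. \<forall>b \<in> Poly_Mapping.keys f. \<exists>a\<in>S. monom_dvd a b}"
  have "ideal ?J (mpoly_ring K n)"
  proof (rule ideal_mpoly_ringI[OF K])
    fix f g assume "f \<in> ?J" "g \<in> ?J"
    then show "f + g \<in> ?J"
      using mpolys_add[OF K, of f n g] Poly_Mapping.keys_add[of f g] by blast
  next
    fix f g assume f: "f \<in> ?J" and g: "g \<in> mpolys K n"
    have "\<exists>a\<in>S. monom_dvd a b" if b: "b \<in> Poly_Mapping.keys (g * f)" for b
    proof -
      from b obtain c d where "d \<in> Poly_Mapping.keys f" and bcd: "b = c + d"
        using keys_mult[of g f] by blast
      then obtain a where a: "a \<in> S" "monom_dvd a d" using f by blast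
      have "monom_dvd d b" unfolding bcd by (simp add: monom_dvd_iff lookup_add)
      then show ?thesis using a monom_dvd_trans by blast
    qed
    then show "g * f \<in> ?J" using f g mpolys_mult[OF K] by blast
  qed (auto simp: mpolys_zero[OF K])
  moreover have "(\<lambda>a. Poly_Mapping.single a 1) ` S \<subseteq> ?J"
  proof
    fix f assume "f \<in> (\<lambda>a. Poly_Mapping.single a (1 :: complex)) ` S"
    then obtain a where "a \<in> S" "f = Poly_Mapping.single a 1" by blast
    then show "f \<in> ?J"
      using assms(1) mpolys_single[OF K subfield_one[OF K], of a n] monom_dvd_refl[of a] by auto
  qed
  ultimately have "Poly_Mapping.single b 1 \<in> ?J"
    using Idl_minimal[OF K] assms(2) by blast
  then show ?thesis by simp
qed

lemma keys_mpolys: "f \<in> mpolys K n \<Longrightarrow> a \<in> Poly_Mapping.keys f \<Longrightarrow> Poly_Mapping.keys a \<subseteq> {1..n}"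
  by (auto simp: mpolys_def)

lemma initial_ideal_eq:
  "initial_ideal K n F =
    Idl\<^bsub>mpoly_ring K n\<^esub> ((\<lambda>a. Poly_Mapping.single a 1) ` lead_monom ` (F - {0}))"
  by (simp add: initial_ideal_def image_image)

lemma lead_monoms_keys:
  assumes "F \<subseteq> mpolys K n"
  shows "lead_monom ` (F - {0}) \<subseteq> {a. Poly_Mapping.keys a \<subseteq> {1..n}}"
proof safe
  fix f i assume "f \<in> F" "f \<noteq> 0" "i \<in> Poly_Mapping.keys (lead_monom f)"
  then show "i \<in> {1..n}"
    using keys_mpolys[of f "lead_monom f"] lead_monom_in_keys[of f] assms by blast
qed

lemma lead_singles_mpolys:
  assumes "F \<subseteq> mpolys K n"
  shows "(\<lambda>a. Poly_Mapping.single a 1) ` lead_monom ` (F - {0}) \<subseteq> mpolys K n"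
proof
  fix f assume "f \<in> (\<lambda>a. Poly_Mapping.single a (1 :: complex)) ` lead_monom ` (F - {0})"
  then obtain a where a: "a \<in> lead_monom ` (F - {0})" and f: "f = Poly_Mapping.single a 1" by blast
  show "f \<in> mpolys K n"
    unfolding f using a lead_monoms_keys[OF assms]
    by (intro mpolys_single[OF K subfield_one[OF K]]) (simp add: subset_iff)
qed

lemma ideal_initial_ideal:
  "F \<subseteq> mpolys K n \<Longrightarrow> ideal (initial_ideal K n F) (mpoly_ring K n)"
  unfolding initial_ideal_eq by (rule ideal_Idl[OF K lead_singles_mpolys])

lemma initial_ideal_self:
  assumes "F \<subseteq> mpolys K n" "f \<in> F" "f \<noteq> 0"
  shows "Poly_Mapping.single (lead_monom f) 1 \<in> initial_ideal K n F"
proof -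
  have "Poly_Mapping.single (lead_monom f) 1 \<in> (\<lambda>a. Poly_Mapping.single a (1 :: complex)) ` lead_monom ` (F - {0})"
    using assms by (intro imageI) simp
  then show ?thesis
    unfolding initial_ideal_eq by (rule subsetD[OF Idl_self[OF K lead_singles_mpolys[OF assms(1)]]])
qed

lemma initial_ideal_minimal:
  assumes "ideal J (mpoly_ring K n)"
    and "\<And>f. f \<in> F \<Longrightarrow> f \<noteq> 0 \<Longrightarrow> Poly_Mapping.single (lead_monom f) 1 \<in> J"
  shows "initial_ideal K n F \<subseteq> J"
  unfolding initial_ideal_def by (rule Idl_minimal[OF K assms(1)]) (use assms(2) in auto)

lemma initial_idealD:
  assumes "F \<subseteq> mpolys K n" "Poly_Mapping.single b 1 \<in> initial_ideal K n F"
  shows "\<exists>g\<in>F - {0}. monom_dvd (lead_monom g) b"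
  using monom_ideal_dvd[OF lead_monoms_keys[OF assms(1)] assms(2)[unfolded initial_ideal_eq]]
  by simp

text \<open>
  An initial ideal is a monomial ideal, so equality of initial ideals is a matter of divisibility
  between lead monomials. This is the only form in which Groebner bases are used below.
\<close>

lemma groebner_basis_iff:
  assumes I: "ideal I (mpoly_ring K n)"
  shows "groebner_basis K n I B \<longleftrightarrow> finite B \<and> B \<subseteq> I \<and>
    (\<forall>f\<in>I - {0}. \<exists>g\<in>B - {0}. monom_dvd (lead_monom g) (lead_monom f))"
proof -
  have I_sub: "I \<subseteq> mpolys K n" by (rule ideal_mpoly_ringD(1)[OF K I])
  have ltr: "\<forall>f\<in>I - {0}. \<exists>g\<in>B - {0}. monom_dvd (lead_monom g) (lead_monom f)"
    if B_sub: "B \<subseteq> mpolys K n" and eq: "initial_ideal K n B = initial_ideal K n I"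
  proof
    fix f assume "f \<in> I - {0}"
    then have "Poly_Mapping.single (lead_monom f) 1 \<in> initial_ideal K n B"
      unfolding eq using initial_ideal_self[OF I_sub, of f] by simp
    then show "\<exists>g\<in>B - {0}. monom_dvd (lead_monom g) (lead_monom f)"
      by (rule initial_idealD[OF B_sub])
  qed
  have "initial_ideal K n I \<subseteq> initial_ideal K n B"
    if B_sub: "B \<subseteq> mpolys K n"
      and dvd: "\<forall>f\<in>I - {0}. \<exists>g\<in>B - {0}. monom_dvd (lead_monom g) (lead_monom f)"
  proof (rule initial_ideal_minimal[OF ideal_initial_ideal[OF B_sub]])
    fix f assume f: "f \<in> I" "f \<noteq> 0"
    then have "\<exists>g\<in>B - {0}. monom_dvd (lead_monom g) (lead_monom f)"
      using dvd by simp
    then obtain g c where g: "g \<in> B" "g \<noteq> 0" and fg: "lead_monom f = lead_monom g + c"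
      by (auto simp: monom_dvd_def)
    have "Poly_Mapping.keys (lead_monom f) \<subseteq> {1..n}"
      using f I_sub keys_mpolys[OF _ lead_monom_in_keys[of f]] by (simp add: subset_iff)
    then have "Poly_Mapping.keys c \<subseteq> {1..n}"
      unfolding fg by (simp add: in_keys_iff lookup_add subset_iff)
    then have c: "Poly_Mapping.single c 1 \<in> mpolys K n"
      by (rule mpolys_single[OF K subfield_one[OF K]])
    from ideal_mpoly_ringD(4)[OF K ideal_initial_ideal[OF B_sub] initial_ideal_self[OF B_sub g] c]
    show "Poly_Mapping.single (lead_monom f) 1 \<in> initial_ideal K n B"
      by (simp add: fg mult_single add.commute)
  qed
  moreover have "initial_ideal K n B \<subseteq> initial_ideal K n I" if "B \<subseteq> I"
    using that initial_ideal_self[OF I_sub]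
    by (intro initial_ideal_minimal[OF ideal_initial_ideal[OF I_sub]]) (simp add: subset_iff)
  ultimately show ?thesis
    unfolding groebner_basis_def using ltr subset_trans[OF _ I_sub, of B] by (metis subset_antisym)
qed

text \<open>
  For \<open>h \<in> H\<close> there are \<open>g \<in> G\<close> whose lead monomial divides that of \<open>h\<close>, and \<open>h' \<in> H\<close> whose lead
  monomial divides that of \<open>g\<close>. Reducedness of \<open>H\<close> gives \<open>h' = h\<close>, so \<open>g\<close> and \<open>h\<close> have the same lead
  monomial. If \<open>g - h\<close> were non-zero, its lead monomial
  would be a non-leading monomial of \<open>g\<close> or \<open>h\<close> and yet be divisible by the lead monomial of an
  element of the corresponding basis, which reducedness excludes.
\<close>

lemma reduced_groebner_basis_subset:
  assumes I: "ideal I (mpoly_ring K n)"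
    and G: "reduced_groebner_basis K n I G" and H: "reduced_groebner_basis K n I H"
  shows "H \<subseteq> G"
proof
  from G H have grb: "groebner_basis K n I G" "groebner_basis K n I H"
    by (simp_all add: reduced_groebner_basis_def)
  then have sub: "G \<subseteq> I" "H \<subseteq> I"
    by (simp_all add: groebner_basis_def)
  have "\<forall>f\<in>I - {0}. \<exists>g\<in>G - {0}. monom_dvd (lead_monom g) (lead_monom f)"
    "\<forall>f\<in>I - {0}. \<exists>g\<in>H - {0}. monom_dvd (lead_monom g) (lead_monom f)"
    using grb by (simp_all add: groebner_basis_iff[OF I])
  then have dvdG: "\<exists>g\<in>G. monom_dvd (lead_monom g) (lead_monom f)"
    and dvdH: "\<exists>g\<in>H. monom_dvd (lead_monom g) (lead_monom f)" if "f \<in> I" "f \<noteq> 0" for f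
    using that by blast+
  have monic: "lead_coef f = 1" if "f \<in> G \<union> H" for f
    using G H that by (auto simp: reduced_groebner_basis_def)
  have nz: "f \<noteq> 0" if "f \<in> G \<union> H" for f
    using monic[OF that] by (auto simp: lead_coef_def)
  have redG: "f = g" if "f \<in> G" "g \<in> G" "a \<in> Poly_Mapping.keys g" "monom_dvd (lead_monom f) a" for f g a
    using G that by (auto simp: reduced_groebner_basis_def)
  have redH: "f = g" if "f \<in> H" "g \<in> H" "a \<in> Poly_Mapping.keys g" "monom_dvd (lead_monom f) a" for f g a
    using H that by (auto simp: reduced_groebner_basis_def)
  fix h assume h: "h \<in> H"
  obtain g where g: "g \<in> G" and gh: "monom_dvd (lead_monom g) (lead_monom h)"
    using dvdG[of h] h nz sub by blast
  obtain h' where h': "h' \<in> H" and hg: "monom_dvd (lead_monom h') (lead_monom g)"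
    using dvdH[of g] g nz sub by blast
  have "h' = h"
    using redH[OF h' h lead_monom_in_keys monom_dvd_trans[OF hg gh]] nz h by blast
  then have lead_eq: "lead_monom g = lead_monom h"
    using gh hg monom_dvd_antisym by blast
  have "g - h = 0"
  proof (rule ccontr)
    assume gh_nz: "g - h \<noteq> 0"
    define a where "a = lead_monom (g - h)"
    have gh_I: "g - h \<in> I" using ideal_mpoly_ringD(5)[OF K I] g h sub by blast
    have a: "a \<in> Poly_Mapping.keys (g - h)"
      unfolding a_def by (rule lead_monom_in_keys[OF gh_nz])
    \<comment> \<open>Both are monic with the same lead monomial, so the lead terms cancel in the difference.\<close>
    have "a \<noteq> lead_monom g"
    proof
      assume "a = lead_monom g"
      then have "Poly_Mapping.lookup (g - h) a = lead_coef g - lead_coef h"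
        by (simp add: lead_coef_def lookup_minus lead_eq)
      then show False using a monic g h by (simp add: in_keys_iff)
    qed
    moreover have "a \<in> Poly_Mapping.keys g \<or> a \<in> Poly_Mapping.keys h"
      using a by (auto simp: in_keys_iff lookup_minus)
    moreover have "a = lead_monom g" if ag: "a \<in> Poly_Mapping.keys g"
    proof -
      obtain g' where "g' \<in> G" "monom_dvd (lead_monom g') a"
        using dvdG[OF gh_I gh_nz] unfolding a_def by blast
      with redG[OF _ g ag] have "monom_dvd (lead_monom g) a" by blast
      then show ?thesis using le_lead_monom[OF ag] monom_dvd_imp_le by fastforce
    qed
    moreover have "a = lead_monom g" if ah: "a \<in> Poly_Mapping.keys h"
    proof -
      obtain h' where "h' \<in> H" "monom_dvd (lead_monom h') a"
        using dvdH[OF gh_I gh_nz] unfolding a_def by blast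
      with redH[OF _ h ah] have "monom_dvd (lead_monom h) a" by blast
      then show ?thesis using le_lead_monom[OF ah] monom_dvd_imp_le lead_eq by fastforce
    qed
    ultimately show False by blast
  qed
  then show "h \<in> G" using g by simp
qed

lemma reduced_groebner_basis_unique:
  assumes "ideal I (mpoly_ring K n)" "reduced_groebner_basis K n I G"
  shows "reduced_groebner_basis K n I H \<longleftrightarrow> H = G"
  using reduced_groebner_basis_subset[OF assms(1)] assms(2) by blast

end

section \<open>Monomial matrices\<close>

text \<open>
  The matrix of the substitution \<open>x\<^sub>i \<mapsto> d\<^sub>i x\<^bsub>t(i)\<^esub>\<close>. The data \<open>d\<close> and \<open>t\<close> are indexed by \<open>1, \<dots>, n\<close> like
  the variables, while matrix and vector entries are indexed from 0; this definition and
  \<open>coords\<close> absorb the shift.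
\<close>

definition monomial_mat :: "nat \<Rightarrow> (nat \<Rightarrow> complex) \<Rightarrow> (nat \<Rightarrow> nat) \<Rightarrow> complex mat" where
  "monomial_mat n d t = mat n n (\<lambda>(i, j). if Suc j = t (Suc i) then d (Suc i) else 0)"

definition coords :: "nat \<Rightarrow> (nat \<Rightarrow> complex) \<Rightarrow> complex vec" where
  "coords n v = vec n (\<lambda>i. v (Suc i))"

lemma coords_carrier: "coords n v \<in> carrier_vec n"
  by (simp add: coords_def)

lemma coords_surj:
  assumes "w \<in> carrier_vec n"
  obtains v where "w = coords n v"
proof
  show "w = coords n (\<lambda>i. w $ (i - 1))"
    using assms by (auto simp: coords_def)
qed

lemma monomial_mat_carrier: "monomial_mat n d t \<in> carrier_mat n n"
  by (simp add: monomial_mat_def)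

lemma permutes_Suc_ex:
  assumes "t permutes {1..n}" "i < n"
  obtains j where "j < n" "t (Suc i) = Suc j"
proof -
  have "t (Suc i) \<in> {1..n}" using permutes_in_image[OF assms(1), of "Suc i"] assms(2) by simp
  then show thesis using that[of "t (Suc i) - 1"] by (cases "t (Suc i)") auto
qed

lemma monomial_mat_mult_coords:
  assumes t: "t permutes {1..n}"
  shows "monomial_mat n d t *\<^sub>v coords n v = coords n (\<lambda>i. d i * v (t i))"
proof (rule eq_vecI)
  fix i assume "i < dim_vec (coords n (\<lambda>i. d i * v (t i)))"
  then have i: "i < n" by (simp add: coords_def)
  obtain j where j: "j < n" "t (Suc i) = Suc j" using permutes_Suc_ex[OF t i] .
  have "(monomial_mat n d t *\<^sub>v coords n v) $ i =
      (\<Sum>k = 0..<n. (if Suc k = t (Suc i) then d (Suc i) else 0) * v (Suc k))"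
    using i by (simp add: monomial_mat_def coords_def scalar_prod_def)
  also have "\<dots> = (\<Sum>k = 0..<n. if k = j then d (Suc i) * v (Suc k) else 0)"
    by (rule sum.cong) (auto simp: j)
  also have "\<dots> = coords n (\<lambda>i. d i * v (t i)) $ i"
    using i j by (simp add: coords_def)
  finally show "(monomial_mat n d t *\<^sub>v coords n v) $ i = coords n (\<lambda>i. d i * v (t i)) $ i" .
qed (simp add: monomial_mat_def coords_def)

text \<open>
  The inverse is the transpose with inverted non-zero entries.
\<close>

lemma monomial_mat_Units:
  assumes t: "t permutes {1..n}" and d: "\<And>i. i \<in> {1..n} \<Longrightarrow> d i \<noteq> 0"
  shows "monomial_mat n d t \<in> Units (ring_mat TYPE(complex) n ())"
proof -
  let ?A = "monomial_mat n d t"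
  let ?B = "mat n n (\<lambda>(i, j). if Suc i = t (Suc j) then inverse (d (Suc j)) else 0)"
  have inj: "t i = t j \<longleftrightarrow> i = j" for i j
    using permutes_inj[OF t] by (auto dest: injD)
  have AB: "?A * ?B = 1\<^sub>m n"
  proof (rule eq_matI)
    fix i j assume "i < dim_row (1\<^sub>m n :: complex mat)" "j < dim_col (1\<^sub>m n :: complex mat)"
    then have ij: "i < n" "j < n" by simp_all
    obtain l where l: "l < n" "t (Suc i) = Suc l" using permutes_Suc_ex[OF t ij(1)] .
    have "(?A * ?B) $$ (i, j) = (\<Sum>k = 0..<n. (if Suc k = t (Suc i) then d (Suc i) else 0) *
        (if Suc k = t (Suc j) then inverse (d (Suc j)) else 0))"
      using ij by (simp add: monomial_mat_def scalar_prod_def)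
    also have "\<dots> = (\<Sum>k = 0..<n. if k = l then (if i = j then 1 else 0) else 0)"
      using ij d[of "Suc i"] inj[of "Suc i" "Suc j"] by (intro sum.cong) (auto simp: l)
    also have "\<dots> = 1\<^sub>m n $$ (i, j)" using ij l by simp
    finally show "(?A * ?B) $$ (i, j) = 1\<^sub>m n $$ (i, j)" .
  qed (simp_all add: monomial_mat_def)
  have BA: "?B * ?A = 1\<^sub>m n"
  proof (rule eq_matI)
    fix i j assume "i < dim_row (1\<^sub>m n :: complex mat)" "j < dim_col (1\<^sub>m n :: complex mat)"
    then have ij: "i < n" "j < n" by simp_all
    have "Suc i \<in> t ` {1..n}" using permutes_image[OF t] ij by simp
    then obtain l' where "l' \<in> {1..n}" "t l' = Suc i" by force
    then obtain l where l: "l < n" "t (Suc l) = Suc i"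
      by (metis Suc_le_eq Suc_pred' atLeastAtMost_iff less_eq_Suc_le One_nat_def)
    have k: "Suc i = t (Suc k) \<longleftrightarrow> k = l" for k
      using inj[of "Suc l" "Suc k"] l(2) by auto
    have "(?B * ?A) $$ (i, j) = (\<Sum>k = 0..<n. (if Suc i = t (Suc k) then inverse (d (Suc k)) else 0) *
        (if Suc j = t (Suc k) then d (Suc k) else 0))"
      using ij by (simp add: monomial_mat_def scalar_prod_def)
    also have "\<dots> = (\<Sum>k = 0..<n. if k = l then (if i = j then 1 else 0) else 0)"
      unfolding k using d[of "Suc l"] l by (intro sum.cong) auto
    also have "\<dots> = 1\<^sub>m n $$ (i, j)" using ij l by simp
    finally show "(?B * ?A) $$ (i, j) = 1\<^sub>m n $$ (i, j)" .
  qed (simp_all add: monomial_mat_def)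
  show ?thesis
    unfolding Units_def ring_mat_simps using AB BA monomial_mat_carrier[of n d t]
    by (auto intro!: bexI[of _ ?B])
qed

lemma prod_nonzero_entries:
  assumes t: "t permutes {1..n}" and d: "\<And>i. i \<in> {1..n} \<Longrightarrow> d i \<noteq> 0"
  shows "(\<Prod>(i, j) \<in> {(i, j). i < n \<and> j < n \<and> monomial_mat n d t $$ (i, j) \<noteq> 0}. monomial_mat n d t $$ (i, j))
    = (\<Prod>i\<in>{1..n}. d i)"
proof -
  have iff: "i < n \<and> j < n \<and> monomial_mat n d t $$ (i, j) \<noteq> 0 \<longleftrightarrow> i < n \<and> j = t (Suc i) - 1" for i j
  proof (cases "i < n")
    case True
    obtain l where "l < n" "t (Suc i) = Suc l" using permutes_Suc_ex[OF t True] .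
    then show ?thesis using True d[of "Suc i"] by (auto simp: monomial_mat_def split: if_splits)
  qed simp
  have "{(i, j). i < n \<and> j < n \<and> monomial_mat n d t $$ (i, j) \<noteq> 0} = (\<lambda>i. (i, t (Suc i) - 1)) ` {..<n}"
    unfolding iff by auto
  then have "(\<Prod>(i, j) \<in> {(i, j). i < n \<and> j < n \<and> monomial_mat n d t $$ (i, j) \<noteq> 0}. monomial_mat n d t $$ (i, j))
      = (\<Prod>i<n. monomial_mat n d t $$ (i, t (Suc i) - 1))"
    by (simp add: prod.reindex inj_on_def)
  also have "\<dots> = (\<Prod>i<n. d (Suc i))"
  proof (rule prod.cong)
    fix i assume "i \<in> {..<n}"
    then have i: "i < n" by simp
    obtain l where "l < n" "t (Suc i) = Suc l" using permutes_Suc_ex[OF t i] .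
    then show "monomial_mat n d t $$ (i, t (Suc i) - 1) = d (Suc i)"
      using i by (simp add: monomial_mat_def)
  qed simp
  also have "\<dots> = (\<Prod>i\<in>{1..n}. d i)"
    using prod.atLeast1_atMost_eq[of d n] by simp
  finally show ?thesis .
qed

lemma root_of_unity_nonzero: "(z::complex) ^ m = 1 \<Longrightarrow> 1 \<le> m \<Longrightarrow> z \<noteq> 0"
  by (auto simp: power_0_left)

lemma monomial_mat_in_G_group:
  assumes t: "t permutes {1..n}" and d: "\<And>i. i \<in> {1..n} \<Longrightarrow> d i ^ m = 1"
    and prod: "(\<Prod>i\<in>{1..n}. d i) ^ (m div p) = 1"
    and K: "\<forall>z. z ^ m = 1 \<longrightarrow> z \<in> K" "0 \<in> K" and m: "1 \<le> m"
  shows "monomial_mat n d t \<in> G_group K m p n"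
proof -
  have dnz: "d i \<noteq> 0" if "i \<in> {1..n}" for i
    using root_of_unity_nonzero[OF d[OF that] m] .
  have entry: "monomial_mat n d t $$ (i, j) = (if Suc j = t (Suc i) then d (Suc i) else 0)"
    if "i < n" "j < n" for i j using that by (simp add: monomial_mat_def)
  have row: "\<exists>!j. j < n \<and> monomial_mat n d t $$ (i, j) \<noteq> 0" if i: "i < n" for i
  proof -
    obtain j where j: "j < n" "t (Suc i) = Suc j" using permutes_Suc_ex[OF t i] .
    show ?thesis
      by (rule ex1I[of _ j]) (use i j dnz[of "Suc i"] in \<open>auto simp: entry split: if_splits\<close>)
  qed
  have col: "\<exists>!i. i < n \<and> monomial_mat n d t $$ (i, j) \<noteq> 0" if j: "j < n" for j
  proof -
    have "Suc j \<in> t ` {1..n}" using permutes_image[OF t] j by simp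
    then obtain i' where "i' \<in> {1..n}" "t i' = Suc j" by force
    then obtain i where i: "i < n" "t (Suc i) = Suc j"
      by (metis Suc_le_eq Suc_pred' atLeastAtMost_iff less_eq_Suc_le One_nat_def)
    have k: "Suc j = t (Suc k) \<longleftrightarrow> k = i" for k
      using i(2) permutes_inj[OF t] by (metis injD Suc_inject)
    show ?thesis
      by (rule ex1I[of _ i]) (use i j dnz[of "Suc i"] in \<open>auto simp: entry k split: if_splits\<close>)
  qed
  have "elements_mat (monomial_mat n d t) \<subseteq> K"
    using K d by (auto simp: elements_mat_def monomial_mat_def)
  moreover have "\<forall>i<n. \<forall>j<n. monomial_mat n d t $$ (i, j) \<noteq> 0 \<longrightarrow> monomial_mat n d t $$ (i, j) ^ m = 1"
    using d by (auto simp: entry)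
  moreover have "(\<Prod>(i, j) \<in> {(i, j). i < n \<and> j < n \<and> monomial_mat n d t $$ (i, j) \<noteq> 0}.
      monomial_mat n d t $$ (i, j)) ^ (m div p) = 1"
    by (subst prod_nonzero_entries[OF t]) (use dnz prod in auto)
  moreover have "\<forall>i<n. \<exists>!j. j < n \<and> monomial_mat n d t $$ (i, j) \<noteq> 0"
    "\<forall>j<n. \<exists>!i. i < n \<and> monomial_mat n d t $$ (i, j) \<noteq> 0"
    by (intro allI impI, erule row) (intro allI impI, erule col)
  ultimately show ?thesis
    unfolding G_group_def mem_Collect_eq using monomial_mat_carrier by (intro conjI)
qed

text \<open>
  The permutation sends a row to the column of its unique non-zero entry; uniqueness in the columns
  makes it injective.
\<close>

lemma G_group_obtain:
  assumes A: "A \<in> G_group K m p n" and m: "1 \<le> m"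
  obtains d t where "t permutes {1..n}" "A = monomial_mat n d t"
    "\<And>i. i \<in> {1..n} \<Longrightarrow> d i ^ m = 1" "(\<Prod>i\<in>{1..n}. d i) ^ (m div p) = 1"
proof -
  have carr: "A \<in> carrier_mat n n"
    and row: "\<And>i. i < n \<Longrightarrow> \<exists>!j. j < n \<and> A $$ (i, j) \<noteq> 0"
    and col: "\<And>j. j < n \<Longrightarrow> \<exists>!i. i < n \<and> A $$ (i, j) \<noteq> 0"
    and root: "\<And>i j. i < n \<Longrightarrow> j < n \<Longrightarrow> A $$ (i, j) \<noteq> 0 \<Longrightarrow> A $$ (i, j) ^ m = 1"
    and prod: "(\<Prod>(i, j) \<in> {(i, j). i < n \<and> j < n \<and> A $$ (i, j) \<noteq> 0}. A $$ (i, j)) ^ (m div p) = 1"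
    using A unfolding G_group_def by simp_all
  define c where "c i = (THE j. j < n \<and> A $$ (i, j) \<noteq> 0)" for i
  have c: "c i < n" "A $$ (i, c i) \<noteq> 0" if "i < n" for i
    using theI'[OF row[OF that]] by (simp_all add: c_def)
  have c_unique: "j = c i" if "i < n" "j < n" "A $$ (i, j) \<noteq> 0" for i j
    using row[OF that(1)] c[OF that(1)] that by blast
  define t where "t k = (if k \<in> {1..n} then Suc (c (k - 1)) else k)" for k
  define d where "d k = A $$ (k - 1, c (k - 1))" for k
  have "inj_on t {1..n}"
  proof (rule inj_onI)
    fix k l assume kl: "k \<in> {1..n}" "l \<in> {1..n}" "t k = t l"
    then have lt: "k - 1 < n" "l - 1 < n" and "c (k - 1) = c (l - 1)" by (auto simp: t_def)
    then have "k - 1 = l - 1" using col[OF c(1)[OF lt(1)]] c[of "k - 1"] c[of "l - 1"] by auto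
    then show "k = l" using kl by auto
  qed
  moreover have "t ` {1..n} \<subseteq> {1..n}"
  proof
    fix k assume "k \<in> t ` {1..n}"
    then obtain l where "l \<in> {1..n}" "k = Suc (c (l - 1))" by (auto simp: t_def)
    moreover from this have "l - 1 < n" by auto
    ultimately show "k \<in> {1..n}" using c(1)[of "l - 1"] by simp
  qed
  ultimately have "bij_betw t {1..n} {1..n}"
    by (simp add: bij_betw_def endo_inj_surj)
  then have t: "t permutes {1..n}"
    by (rule bij_imp_permutes) (auto simp: t_def)
  have A_eq: "A = monomial_mat n d t"
  proof (rule eq_matI)
    fix i j assume "i < dim_row (monomial_mat n d t)" "j < dim_col (monomial_mat n d t)"
    then have "i < n" "j < n" by (simp_all add: monomial_mat_def)
    then show "A $$ (i, j) = monomial_mat n d t $$ (i, j)"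
      using c_unique[of i j] by (auto simp: monomial_mat_def d_def t_def)
  qed (use carr in \<open>auto simp: monomial_mat_def\<close>)
  have d: "d i ^ m = 1" if "i \<in> {1..n}" for i
  proof -
    have i: "i - 1 < n" using that by auto
    show ?thesis unfolding d_def by (rule root[OF i c[OF i]])
  qed
  have "(\<Prod>(i, j) \<in> {(i, j). i < n \<and> j < n \<and> A $$ (i, j) \<noteq> 0}. A $$ (i, j)) = (\<Prod>i\<in>{1..n}. d i)"
    unfolding A_eq by (rule prod_nonzero_entries[OF t root_of_unity_nonzero[OF d m]])
  then have "(\<Prod>i\<in>{1..n}. d i) ^ (m div p) = 1"
    using prod by simp
  from that[OF t A_eq d this] show thesis .
qed

lemma G_group_Units:
  assumes "A \<in> G_group K m p n" "1 \<le> m"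
  shows "A \<in> Units (ring_mat TYPE(complex) n ())"
proof -
  obtain d t where dt: "t permutes {1..n}" "A = monomial_mat n d t" "\<And>i. i \<in> {1..n} \<Longrightarrow> d i ^ m = 1"
    using G_group_obtain[OF assms] by blast
  show ?thesis
    unfolding dt(2) by (rule monomial_mat_Units[OF dt(1)]) (rule root_of_unity_nonzero[OF dt(3) assms(2)])
qed

lemma Units_ring_mat_cancel:
  assumes A: "A \<in> Units (ring_mat TYPE(complex) n ())" and v: "v \<in> carrier_vec n"
  defines "B \<equiv> m_inv (ring_mat TYPE(complex) n ()) A"
  shows "B \<in> carrier_mat n n" "A *\<^sub>v (B *\<^sub>v v) = v" "B *\<^sub>v (A *\<^sub>v v) = v"
proof -
  interpret R: ring "ring_mat TYPE(complex) n ()" by (rule ring_mat)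
  have A_carr: "A \<in> carrier_mat n n" using R.Units_closed[OF A] by (simp add: ring_mat_simps)
  show B: "B \<in> carrier_mat n n"
    using R.Units_inv_closed[OF A] by (simp add: ring_mat_simps B_def)
  have "A * B = 1\<^sub>m n" "B * A = 1\<^sub>m n"
    using R.Units_r_inv[OF A] R.Units_l_inv[OF A] by (simp_all add: ring_mat_simps B_def)
  then show "A *\<^sub>v (B *\<^sub>v v) = v" "B *\<^sub>v (A *\<^sub>v v) = v"
    using assoc_mult_mat_vec[OF A_carr B v] assoc_mult_mat_vec[OF B A_carr v] v by simp_all
qed

text \<open>
  The group action is defined through inverse matrices. Since \<open>v\<close> and \<open>\<sigma> v\<close> range over the same vectors,
  invariance may be tested on \<open>f(\<sigma> v) = f(v)\<close>, which avoids inverting; this lemma and the next one are the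
  two directions.
\<close>

lemma invariant_G_groupI:
  assumes "1 \<le> m"
    and "\<And>d t v. t permutes {1..n} \<Longrightarrow> (\<And>i. i \<in> {1..n} \<Longrightarrow> d i ^ m = 1) \<Longrightarrow>
      (\<Prod>i\<in>{1..n}. d i) ^ (m div p) = 1 \<Longrightarrow>
      mpoly_eval f (coords n (\<lambda>i. d i * v (t i))) = mpoly_eval f (coords n v)"
  shows "invariant K n (G_group K m p n) f"
  unfolding invariant_def act_def
proof (intro ballI impI)
  fix A and w :: "complex vec"
  assume A: "A \<in> G_group K m p n" and w: "w \<in> carrier_vec n"
  let ?B = "m_inv (ring_mat TYPE(complex) n ()) A"
  note cancel = Units_ring_mat_cancel[OF G_group_Units[OF A assms(1)] w]
  obtain v where v: "?B *\<^sub>v w = coords n v"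
    using coords_surj[of "?B *\<^sub>v w" n] mult_mat_vec_carrier[OF cancel(1) w] by blast
  obtain d t where dt: "t permutes {1..n}" "A = monomial_mat n d t"
    "\<And>i. i \<in> {1..n} \<Longrightarrow> d i ^ m = 1" "(\<Prod>i\<in>{1..n}. d i) ^ (m div p) = 1"
    using G_group_obtain[OF A assms(1)] by blast
  have "w = coords n (\<lambda>i. d i * v (t i))"
    using cancel(2)[unfolded v] monomial_mat_mult_coords[OF dt(1), of d v] dt(2) by simp
  then show "mpoly_eval f (?B *\<^sub>v w) = mpoly_eval f w"
    using assms(2)[OF dt(1,3,4), of v] unfolding v by simp
qed

lemma invariant_G_groupD:
  assumes inv: "invariant K n (G_group K m p n) f"
    and K: "subfield K (class_ring :: complex ring)" "\<forall>z. z ^ m = 1 \<longrightarrow> z \<in> K" and m: "1 \<le> m"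
    and t: "t permutes {1..n}" and d: "\<And>i. i \<in> {1..n} \<Longrightarrow> d i ^ m = 1"
    and prod: "(\<Prod>i\<in>{1..n}. d i) ^ (m div p) = 1" and v: "\<And>i. v i \<in> K"
  shows "mpoly_eval f (coords n (\<lambda>i. d i * v (t i))) = mpoly_eval f (coords n v)"
proof -
  let ?A = "monomial_mat n d t" and ?w = "coords n (\<lambda>i. d i * v (t i))"
  have A: "?A \<in> G_group K m p n"
    by (rule monomial_mat_in_G_group[OF t d prod K(2) subfield_zero[OF K(1)] m])
  have "set\<^sub>v ?w \<subseteq> K"
    using K(2) d v by (auto simp: vec_set_def coords_def intro!: subfield_mult[OF K(1)])
  then have "mpoly_eval f (m_inv (ring_mat TYPE(complex) n ()) ?A *\<^sub>v ?w) = mpoly_eval f ?w"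
    using inv A coords_carrier unfolding invariant_def act_def by blast
  then show ?thesis
    using Units_ring_mat_cancel(3)[OF G_group_Units[OF A m] coords_carrier[of n v]]
      monomial_mat_mult_coords[OF t, of d v] by simp
qed

section \<open>Coefficients of invariants\<close>

text \<open>
  By induction on the number of variables: for fixed values of the others, the sum is a univariate
  polynomial with infinitely many roots, so the terms of each fixed degree in \<open>x\<close> cancel separately.
  The exponents are an injective family rather than a set of exponent vectors because restricting
  vectors to fewer variables is injective only within one degree in \<open>x\<close>.
\<close>

lemma monomial_functions_independent:
  fixes c :: "'b \<Rightarrow> complex" and e :: "'b \<Rightarrow> nat \<Rightarrow> nat"
  assumes K: "infinite K"
    and "finite S" "finite F"
    and "\<And>a b. a \<in> F \<Longrightarrow> b \<in> F \<Longrightarrow> (\<And>i. i \<in> S \<Longrightarrow> e a i = e b i) \<Longrightarrow> a = b"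
    and "\<And>v. (\<And>i. v i \<in> K) \<Longrightarrow> (\<Sum>a\<in>F. c a * (\<Prod>i\<in>S. v i ^ e a i)) = 0"
    and "a \<in> F"
  shows "c a = 0"
  using assms(2-)
proof (induction S arbitrary: F rule: finite_induct)
  case empty
  then have "F = {a}" by blast
  moreover obtain z where "z \<in> K" using K by fastforce
  ultimately show ?case using empty.prems(3)[of "\<lambda>_. z"] by simp
next
  case (insert x S)
  define F' where "F' = {b \<in> F. e b x = e a x}"
  have "(\<Sum>b\<in>F'. c b * (\<Prod>i\<in>S. v i ^ e b i)) = 0" if v: "\<And>i. v i \<in> K" for v
  proof -
    define p where "p = (\<Sum>b\<in>F. monom (c b * (\<Prod>i\<in>S. v i ^ e b i)) (e b x))"
    have "poly p t = 0" if t: "t \<in> K" for t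
    proof -
      have "(\<Prod>i\<in>insert x S. (v(x := t)) i ^ e b i) = t ^ e b x * (\<Prod>i\<in>S. v i ^ e b i)" for b
      proof -
        have "(\<Prod>i\<in>S. (v(x := t)) i ^ e b i) = (\<Prod>i\<in>S. v i ^ e b i)"
          using insert.hyps by (intro prod.cong) auto
        then show ?thesis using insert.hyps by simp
      qed
      then have "poly p t = (\<Sum>b\<in>F. c b * (\<Prod>i\<in>insert x S. (v(x := t)) i ^ e b i))"
        by (simp add: p_def poly_sum poly_monom mult_ac)
      also have "\<dots> = 0"
        by (rule insert.prems(3)) (use v t in auto)
      finally show ?thesis .
    qed
    then have "K \<subseteq> {t. poly p t = 0}" by blast
    then have "p = 0" using K poly_roots_finite[of p] finite_subset by blast
    then have "coeff p (e a x) = 0" by simp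
    then have "(\<Sum>b\<in>F. if e b x = e a x then c b * (\<Prod>i\<in>S. v i ^ e b i) else 0) = 0"
      by (simp add: p_def coeff_sum)
    then show ?thesis
      using insert.prems(1) by (simp add: F'_def sum.If_cases Int_def)
  qed
  moreover have "b = b'" if "b \<in> F'" "b' \<in> F'" "\<And>i. i \<in> S \<Longrightarrow> e b i = e b' i" for b b'
    using that by (intro insert.prems(2)) (auto simp: F'_def)
  ultimately show ?case
    using insert.prems(1,4) by (intro insert.IH[of F']) (auto simp: F'_def)
qed

lemma mpoly_eval_coords:
  assumes "f \<in> mpolys K n"
  shows "mpoly_eval f (coords n v) =
    (\<Sum>a\<in>Poly_Mapping.keys f. Poly_Mapping.lookup f a * (\<Prod>i\<in>{1..n}. v i ^ Poly_Mapping.lookup a i))"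
  unfolding mpoly_eval_def
proof (rule sum.cong)
  fix a assume "a \<in> Poly_Mapping.keys f"
  then have a: "Poly_Mapping.keys a \<subseteq> {1..n}" using assms by (auto simp: mpolys_def)
  have "(\<Prod>i\<in>Poly_Mapping.keys a. (coords n v $ (i - 1)) ^ Poly_Mapping.lookup a i) =
      (\<Prod>i\<in>Poly_Mapping.keys a. v i ^ Poly_Mapping.lookup a i)"
  proof (rule prod.cong)
    fix i assume "i \<in> Poly_Mapping.keys a"
    then have "i \<in> {1..n}" using a by blast
    then have "i - 1 < n" "Suc (i - 1) = i" by auto
    then show "(coords n v $ (i - 1)) ^ Poly_Mapping.lookup a i = v i ^ Poly_Mapping.lookup a i"
      by (simp add: coords_def)
  qed simp
  also have "\<dots> = (\<Prod>i\<in>{1..n}. v i ^ Poly_Mapping.lookup a i)"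
    using a by (intro prod.mono_neutral_left) (auto simp: in_keys_iff)
  finally show "Poly_Mapping.lookup f a * (\<Prod>i\<in>Poly_Mapping.keys a. (coords n v $ (i - 1)) ^ Poly_Mapping.lookup a i)
      = Poly_Mapping.lookup f a * (\<Prod>i\<in>{1..n}. v i ^ Poly_Mapping.lookup a i)" by simp
qed simp

lemma monom_eqI_on:
  assumes "Poly_Mapping.keys a \<subseteq> S" "Poly_Mapping.keys b \<subseteq> S"
    and "\<And>i. i \<in> S \<Longrightarrow> Poly_Mapping.lookup a i = Poly_Mapping.lookup b i"
  shows "a = (b :: monom)"
  by (rule poly_mapping_eqI) (metis assms in_keys_iff subsetD)

lemma lookup_map_key_transpose:
  "Poly_Mapping.lookup (Poly_Mapping.map_key (transpose i j) a) k = Poly_Mapping.lookup a (transpose i j k)"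
  by (simp add: map_key.rep_eq)

lemma map_key_transpose_invol:
  "Poly_Mapping.map_key (transpose i j) (Poly_Mapping.map_key (transpose i j) a) = a"
  by (rule poly_mapping_eqI) (simp add: lookup_map_key_transpose)

lemma exists_primitive_root_of_unity:
  assumes "1 \<le> m"
  obtains z :: complex where "z ^ m = 1" "\<And>k. z ^ k = 1 \<longleftrightarrow> m dvd k"
proof
  let ?z = "cis (2 * pi / real m)"
  have pow: "?z ^ k = cis (2 * pi * real k / real m)" for k
    by (simp add: DeMoivre mult_ac)
  show one: "?z ^ m = 1" using assms by (simp add: pow)
  show "?z ^ k = 1 \<longleftrightarrow> m dvd k" for k
  proof
    assume k: "?z ^ k = 1"
    have "?z ^ k = ?z ^ (m * (k div m) + k mod m)" by simp
    also have "\<dots> = ?z ^ (k mod m)" unfolding power_add power_mult one by simp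
    finally have "cis (2 * pi * real (k mod m) / real m) = cis (2 * pi * real 0 / real m)"
      using k by (simp add: pow)
    moreover have "inj_on (\<lambda>k. cis (2 * pi * real k / real m)) {..<m}"
      using bij_betw_roots_unity[of m] assms by (simp add: bij_betw_def)
    ultimately have "k mod m = 0"
      using assms by (auto dest!: inj_onD[of _ _ "k mod m" 0])
    then show "m dvd k" by auto
  qed (auto elim!: dvdE simp: power_mult one)
qed

context
  fixes K :: "complex set" and m p n :: nat and f :: mpoly
  assumes K: "subfield K (class_ring :: complex ring)" and roots: "\<forall>z. z ^ m = 1 \<longrightarrow> z \<in> K"
    and m: "1 \<le> m" and p: "p dvd m"
    and f: "f \<in> mpolys K n" and inv: "invariant K n (G_group K m p n) f"
begin

lemma infinite_subfield: "infinite K"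
proof
  assume "finite K"
  moreover have "range of_nat \<subseteq> K" using subfield_of_nat[OF K] by blast
  ultimately have "finite (range (of_nat :: nat \<Rightarrow> complex))" by (rule rev_finite_subset)
  then have "finite (UNIV :: nat set)" by (rule finite_imageD) (simp add: inj_on_def)
  then show False by simp
qed

text \<open>
  A diagonal matrix multiplies each monomial by a scalar, so every monomial of an invariant has to be
  fixed on its own.
\<close>

lemma keys_invariant_diagonal:
  fixes d :: "nat \<Rightarrow> complex"
  assumes d: "\<And>i. i \<in> {1..n} \<Longrightarrow> d i ^ m = 1" and prod: "(\<Prod>i\<in>{1..n}. d i) ^ (m div p) = 1"
    and a: "a \<in> Poly_Mapping.keys f"
  shows "(\<Prod>i\<in>{1..n}. d i ^ Poly_Mapping.lookup a i) = 1"
proof -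
  let ?D = "\<lambda>a. \<Prod>i\<in>{1..n}. d i ^ Poly_Mapping.lookup a i"
  have "Poly_Mapping.lookup f a * (?D a - 1) = 0"
  proof (rule monomial_functions_independent[where F = "Poly_Mapping.keys f" and S = "{1..n}"
        and e = Poly_Mapping.lookup and K = K])
    fix v :: "nat \<Rightarrow> complex" assume v: "\<And>i. v i \<in> K"
    have "(\<Sum>a\<in>Poly_Mapping.keys f. Poly_Mapping.lookup f a * (?D a - 1) * (\<Prod>i\<in>{1..n}. v i ^ Poly_Mapping.lookup a i))
        = mpoly_eval f (coords n (\<lambda>i. d i * v i)) - mpoly_eval f (coords n v)"
      unfolding mpoly_eval_coords[OF f] sum_subtractf[symmetric]
      by (rule sum.cong) (simp_all add: power_mult_distrib prod.distrib algebra_simps)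
    also have "\<dots> = 0"
      using invariant_G_groupD[OF inv K roots m permutes_id d prod v] by simp
    finally show "(\<Sum>a\<in>Poly_Mapping.keys f. Poly_Mapping.lookup f a * (?D a - 1) *
        (\<Prod>i\<in>{1..n}. v i ^ Poly_Mapping.lookup a i)) = 0" .
  next
    fix a b assume "a \<in> Poly_Mapping.keys f" "b \<in> Poly_Mapping.keys f"
      "\<And>i. i \<in> {1..n} \<Longrightarrow> Poly_Mapping.lookup a i = Poly_Mapping.lookup b i"
    then show "a = b"
      using keys_mpolys[OF K f] by (intro monom_eqI_on[of a "{1..n}" b]) auto
  qed (use a infinite_subfield in auto)
  then show ?thesis using a by (simp add: in_keys_iff)
qed

lemma prod_power_if_eq:
  assumes "j \<in> {1..n}"
  shows "(\<Prod>k\<in>{1..n}. (if k = j then z else 1) ^ e k) = (z :: complex) ^ e j"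
proof -
  have "(\<Prod>k\<in>{1..n}. (if k = j then z else 1) ^ e k) = (\<Prod>k\<in>{1..n}. if k = j then z ^ e k else 1)"
    by (rule prod.cong) auto
  then show ?thesis using assms by simp
qed

text \<open>
  The diagonal matrix with entries \<open>\<zeta>\<close> at \<open>i\<close> and \<open>\<zeta>\<^sup>-\<^sup>1\<close> at \<open>j\<close>, for a primitive \<open>m\<close>-th root of unity \<open>\<zeta>\<close>,
  belongs to the group.
\<close>

lemma keys_invariant_cong:
  assumes a: "a \<in> Poly_Mapping.keys f" and ij: "i \<in> {1..n}" "j \<in> {1..n}"
  shows "Poly_Mapping.lookup a i mod m = Poly_Mapping.lookup a j mod m"
proof -
  obtain z :: complex where z: "z ^ m = 1" "\<And>k. z ^ k = 1 \<longleftrightarrow> m dvd k"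
    using exists_primitive_root_of_unity[OF m] by blast
  have z0: "z \<noteq> 0" using root_of_unity_nonzero[OF z(1) m] .
  have pow: "z ^ k = z ^ l \<longleftrightarrow> k mod m = l mod m" if "k \<le> l" for k l
  proof -
    have "z ^ l = z ^ k * z ^ (l - k)" using that by (simp add: power_add[symmetric])
    then have "z ^ k = z ^ l \<longleftrightarrow> m dvd l - k" using z0 by (auto simp flip: z(2))
    then show ?thesis using that by (metis mod_eq_dvd_iff_nat)
  qed
  \<comment> \<open>Written as a product so that the case \<open>i = j\<close> needs no separate treatment.\<close>
  let ?d = "\<lambda>k. (if k = i then z else 1) * (if k = j then inverse z else 1)"
  have prod1: "(\<Prod>k\<in>{1..n}. ?d k ^ e k) = z ^ e i * inverse z ^ e j" for e
    using ij by (simp only: power_mult_distrib prod.distrib prod_power_if_eq)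
  have "(\<Prod>k\<in>{1..n}. ?d k ^ Poly_Mapping.lookup a k) = 1"
  proof (rule keys_invariant_diagonal[OF _ _ a])
    show "(\<Prod>k\<in>{1..n}. ?d k) ^ (m div p) = 1"
      using prod1[of "\<lambda>_. 1"] z0 by simp
    show "?d k ^ m = 1" for k by (simp add: power_mult_distrib z(1) power_inverse)
  qed
  then have "z ^ Poly_Mapping.lookup a i = z ^ Poly_Mapping.lookup a j"
    unfolding prod1 using z0 by (simp add: field_simps power_inverse)
  then show ?thesis using pow by (metis nle_le)
qed

text \<open>
  The diagonal matrix with \<open>\<zeta>\<^sup>p\<close> at \<open>i\<close> and 1 elsewhere belongs to the group.
\<close>

lemma keys_invariant_dvd:
  assumes a: "a \<in> Poly_Mapping.keys f" and i: "i \<in> {1..n}"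
  shows "m div p dvd Poly_Mapping.lookup a i"
proof -
  obtain z :: complex where z: "z ^ m = 1" "\<And>k. z ^ k = 1 \<longleftrightarrow> m dvd k"
    using exists_primitive_root_of_unity[OF m] by blast
  have mp: "p * (m div p) = m" using p by simp
  let ?d = "\<lambda>k. if k = i then z ^ p else 1"
  have prod1: "(\<Prod>k\<in>{1..n}. ?d k ^ e k) = (z ^ p) ^ e i" for e
    using prod_power_if_eq[OF i] .
  have "(\<Prod>k\<in>{1..n}. ?d k ^ Poly_Mapping.lookup a k) = 1"
  proof (rule keys_invariant_diagonal[OF _ _ a])
    show "(\<Prod>k\<in>{1..n}. ?d k) ^ (m div p) = 1"
      using prod1[of "\<lambda>_. 1"] z mp by (simp add: power_mult[symmetric])
    show "?d k ^ m = 1" for k using z(1) by (simp add: power_commutes flip: power_mult) (metis mult.commute power_mult power_one)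
  qed
  then have "m dvd p * Poly_Mapping.lookup a i"
    unfolding prod1 by (simp add: power_mult[symmetric] z(2))
  then have "p * (m div p) dvd p * Poly_Mapping.lookup a i" by (simp only: mp)
  moreover have "p \<noteq> 0" using mp m by (intro notI) simp
  ultimately show ?thesis by (simp only: nat_mult_dvd_cancel_disj simp_thms)
qed

text \<open>
  Transpositions of coordinates belong to the group, so the coefficients of an invariant are
  symmetric functions of the exponents.
\<close>

lemma lookup_invariant_transpose:
  assumes ij: "i \<in> {1..n}" "j \<in> {1..n}"
  shows "Poly_Mapping.lookup f (Poly_Mapping.map_key (transpose i j) a) = Poly_Mapping.lookup f a"
proof -
  let ?t = "transpose i j" and ?k = "Poly_Mapping.map_key (transpose i j) :: monom \<Rightarrow> monom"
  let ?F = "Poly_Mapping.keys f \<union> ?k ` Poly_Mapping.keys f"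
  have t: "?t permutes {1..n}" using ij by (rule permutes_swap_id)
  have keys_k: "Poly_Mapping.keys (?k b) \<subseteq> {1..n}" if "b \<in> Poly_Mapping.keys f" for b
  proof
    fix x assume "x \<in> Poly_Mapping.keys (?k b)"
    then have "?t x \<in> Poly_Mapping.keys b" by (simp add: in_keys_iff lookup_map_key_transpose)
    then have "?t x \<in> {1..n}" using keys_mpolys[OF K f that] by blast
    then show "x \<in> {1..n}" using permutes_in_image[OF t] by blast
  qed
  have keys_F: "Poly_Mapping.keys b \<subseteq> {1..n}" if "b \<in> ?F" for b
    using that keys_k keys_mpolys[OF K f] by blast
  have coef: "Poly_Mapping.lookup f (?k b) - Poly_Mapping.lookup f b = 0" if b: "b \<in> ?F" for b
  proof (rule monomial_functions_independent[where F = ?F and S = "{1..n}"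
        and e = Poly_Mapping.lookup and K = K])
    fix v :: "nat \<Rightarrow> complex" assume v: "\<And>i. v i \<in> K"
    let ?M = "\<lambda>v a. \<Prod>i\<in>{1..n}. v i ^ Poly_Mapping.lookup a i"
    have M: "?M (\<lambda>i. v (?t i)) b = ?M v (?k b)" for b
      using prod.permute[OF t, of "\<lambda>i. v i ^ Poly_Mapping.lookup b (?t i)"]
      by (simp add: lookup_map_key_transpose o_def)
    have inj: "inj_on ?k (Poly_Mapping.keys f)"
      by (rule inj_on_inverseI[of _ ?k]) (rule map_key_transpose_invol)
    have "mpoly_eval f (coords n (\<lambda>i. 1 * v (?t i))) = (\<Sum>b\<in>Poly_Mapping.keys f. Poly_Mapping.lookup f b * ?M v (?k b))"
      unfolding mpoly_eval_coords[OF f] by (simp only: M mult_1)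
    also have "\<dots> = (\<Sum>b\<in>?k ` Poly_Mapping.keys f. Poly_Mapping.lookup f (?k b) * ?M v b)"
      by (simp add: sum.reindex[OF inj] map_key_transpose_invol)
    also have "\<dots> = (\<Sum>b\<in>?F. Poly_Mapping.lookup f (?k b) * ?M v b)"
    proof (rule sum.mono_neutral_left)
      have "Poly_Mapping.lookup f (?k b) = 0" if "b \<notin> ?k ` Poly_Mapping.keys f" for b
        using that imageI[of "?k b" "Poly_Mapping.keys f" ?k]
        by (simp only: map_key_transpose_invol in_keys_iff) blast
      then show "\<forall>b\<in>?F - ?k ` Poly_Mapping.keys f. Poly_Mapping.lookup f (?k b) * ?M v b = 0"
        by simp
    qed auto
    finally have 1: "mpoly_eval f (coords n (\<lambda>i. 1 * v (?t i))) = (\<Sum>b\<in>?F. Poly_Mapping.lookup f (?k b) * ?M v b)" .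
    have 2: "mpoly_eval f (coords n v) = (\<Sum>b\<in>?F. Poly_Mapping.lookup f b * ?M v b)"
      unfolding mpoly_eval_coords[OF f]
      by (rule sum.mono_neutral_left) (auto simp: in_keys_iff)
    have "mpoly_eval f (coords n (\<lambda>i. 1 * v (?t i))) = mpoly_eval f (coords n v)"
      by (rule invariant_G_groupD[OF inv K roots m t _ _ v]) simp_all
    then show "(\<Sum>b\<in>?F. (Poly_Mapping.lookup f (?k b) - Poly_Mapping.lookup f b) * ?M v b) = 0"
      unfolding 1 2 by (simp add: left_diff_distrib sum_subtractf)
  next
    fix a b assume "a \<in> ?F" "b \<in> ?F"
      "\<And>i. i \<in> {1..n} \<Longrightarrow> Poly_Mapping.lookup a i = Poly_Mapping.lookup b i"
    then show "a = b"
      using keys_F by (intro monom_eqI_on[of a "{1..n}" b]) blast+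
  qed (use b infinite_subfield in auto)
  show ?thesis
  proof (cases "a \<in> ?F")
    case False
    then have "a \<notin> Poly_Mapping.keys f" "?k a \<notin> Poly_Mapping.keys f"
      using imageI[of "?k a" "Poly_Mapping.keys f" ?k] by (simp_all only: map_key_transpose_invol) blast+
    then show ?thesis by (simp add: in_keys_iff)
  qed (use coef in simp)
qed

end

section \<open>An alternating functional that vanishes on the ideal\<close>

text \<open>
  The exponents \<open>q - 1, m + q - 1, \<dots>, (n - 1) m + q - 1\<close>, permuted by \<open>s\<close>. For \<open>q = m/p\<close> these are the
  exponent vectors of the monomials of \<open>(x\<^sub>1 \<cdots> x\<^sub>n)\<^bsup>q-1\<^esup> \<Prod>\<^bsub>i<j\<^esub> (x\<^sub>i\<^sup>m - x\<^sub>j\<^sup>m)\<close>, a polynomial that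
  \<open>G(m,p,n)\<close> multiplies by a linear character.
\<close>

definition stair :: "nat \<Rightarrow> nat \<Rightarrow> nat \<Rightarrow> (nat \<Rightarrow> nat) \<Rightarrow> monom" where
  "stair m q n s = expvec {1..n} (\<lambda>i. m * (s i - 1) + q - 1)"

text \<open>
  The coefficient of the monomial \<open>stair m q n id\<close> in the antisymmetrization of \<open>g\<close> over the symmetric group.
\<close>

definition alt_coeff :: "nat \<Rightarrow> nat \<Rightarrow> nat \<Rightarrow> mpoly \<Rightarrow> complex" where
  "alt_coeff m q n g =
    (\<Sum>s | s permutes {1..n}. of_int (sign s) * Poly_Mapping.lookup g (stair m q n s))"

lemma lookup_stair:
  "Poly_Mapping.lookup (stair m q n s) i = (if i \<in> {1..n} then m * (s i - 1) + q - 1 else 0)"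
  by (simp add: stair_def lookup_expvec)

lemma alt_coeff_add: "alt_coeff m q n (f + g) = alt_coeff m q n f + alt_coeff m q n g"
  by (simp add: alt_coeff_def lookup_add distrib_left sum.distrib)

lemma alt_coeff_zero: "alt_coeff m q n 0 = 0"
  by (simp add: alt_coeff_def)

lemma alt_coeff_sum: "alt_coeff m q n (\<Sum>x\<in>X. f x) = (\<Sum>x\<in>X. alt_coeff m q n (f x))"
  by (induction X rule: infinite_finite_induct) (auto simp: alt_coeff_add alt_coeff_zero)

lemma alt_coeff_scale: "alt_coeff m q n (Poly_Mapping.single 0 c * f) = c * alt_coeff m q n f"
proof -
  have "Poly_Mapping.lookup (Poly_Mapping.single 0 c * f) a = c * Poly_Mapping.lookup f a" for a
    unfolding mult_map_scale_conv_mult[symmetric] by (simp add: map.rep_eq when_def)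
  then show ?thesis by (simp add: alt_coeff_def sum_distrib_left mult_ac)
qed

text \<open>
  Right composition with the transposition pairs the permutations off with opposite signs.
\<close>

lemma alternating_sum_eq_0:
  fixes h :: "(nat \<Rightarrow> nat) \<Rightarrow> complex"
  assumes S: "finite S" and ij: "i \<in> S" "j \<in> S" "i \<noteq> j"
    and h: "\<And>s. s permutes S \<Longrightarrow> h (s \<circ> transpose i j) = h s"
  shows "(\<Sum>s | s permutes S. of_int (sign s) * h s) = 0"
proof -
  let ?t = "transpose i j"
  have t: "?t permutes S" using ij by (intro permutes_swap_id)
  have invol: "s \<circ> ?t \<circ> ?t = s" for s :: "nat \<Rightarrow> nat"
    by (simp add: comp_assoc)
  have "(\<Sum>s | s permutes S. of_int (sign s) * h s) =
      (\<Sum>s | s permutes S. of_int (sign (s \<circ> ?t)) * h (s \<circ> ?t))"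
    by (rule sum.reindex_bij_witness[of _ "\<lambda>s. s \<circ> ?t" "\<lambda>s. s \<circ> ?t"])
      (auto simp: invol intro: permutes_compose[OF t])
  also have "\<dots> = (\<Sum>s | s permutes S. - (of_int (sign s) * h s))"
  proof (rule sum.cong)
    fix s assume "s \<in> {s. s permutes S}"
    then have s: "s permutes S" by simp
    have "sign (s \<circ> ?t) = - sign s"
      using sign_compose[OF permutes_imp_permutation[OF S s] permutes_imp_permutation[OF S t]] ij
      by (simp add: sign_swap_id)
    then show "of_int (sign (s \<circ> ?t)) * h (s \<circ> ?t) = - (of_int (sign s) * h s)"
      using h[OF s] by simp
  qed simp
  also have "\<dots> = - (\<Sum>s | s permutes S. of_int (sign s) * h s)"
    by (simp add: sum_negf)
  finally show ?thesis by simp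
qed

lemma permutes_preimage:
  assumes "s permutes S" "y \<in> S"
  obtains x where "x \<in> S" "s x = y"
  using permutes_image[OF assms(1)] assms(2) by force

text \<open>
  The conditions on \<open>c\<close> are those satisfied by the monomials of an invariant. Where the staircase has its least value \<open>q - 1\<close>, divisibility
  by \<open>q\<close> forces the exponent in \<open>c\<close> to be 0; hence all exponents of \<open>c\<close> are multiples of \<open>m\<close>. So each
  exponent of \<open>b\<close> is a staircase value not above the one at its position. As they are distinct,
  induction along the staircase leaves no room for \<open>b\<close> to differ from it.
\<close>

lemma stair_minus_eq_0:
  fixes b c :: monom
  assumes q: "q dvd m" "1 \<le> q" and m: "1 \<le> m" and s: "s permutes {1..n}"
    and bc: "b + c = stair m q n s"
    and inj: "inj_on (Poly_Mapping.lookup b) {1..n}"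
    and cong: "\<And>i j. i \<in> {1..n} \<Longrightarrow> j \<in> {1..n} \<Longrightarrow> Poly_Mapping.lookup c i mod m = Poly_Mapping.lookup c j mod m"
    and dvd: "\<And>i. i \<in> {1..n} \<Longrightarrow> q dvd Poly_Mapping.lookup c i"
  shows "c = 0"
proof -
  let ?b = "Poly_Mapping.lookup b" and ?c = "Poly_Mapping.lookup c"
  have qm: "q \<le> m" using q m by (auto intro: dvd_imp_le)
  have sum: "?b i + ?c i = (if i \<in> {1..n} then m * (s i - 1) + q - 1 else 0)" for i
    using bc by (metis lookup_add lookup_stair)
  have dvd_m: "m dvd ?c i" if i: "i \<in> {1..n}" for i
  proof -
    have "1 \<in> {1..n}" using i by simp
    then obtain i0 where i0: "i0 \<in> {1..n}" "s i0 = 1" by (rule permutes_preimage[OF s])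
    then have "?c i0 < q" using sum[of i0] q(2) by simp
    then have "?c i0 = 0" using dvd[OF i0(1)] by (auto dest: dvd_imp_le)
    then show ?thesis using cong[OF i i0(1)] by auto
  qed
  have c0: "\<forall>i\<in>{1..n}. s i = v \<longrightarrow> ?c i = 0" for v
  proof (induction v rule: less_induct)
    case (less v)
    show ?case
    proof (intro ballI impI, rule ccontr)
      fix i assume i: "i \<in> {1..n}" and v: "s i = v" and nz: "?c i \<noteq> 0"
      obtain e where e: "?c i = m * e" using dvd_m[OF i] by blast
      have si: "s i \<in> {1..n}" using i permutes_in_image[OF s] by blast
      have "m * e < m * s i"
      proof -
        have "m * e \<le> m * (s i - 1) + q - 1" using sum[of i] i e by simp
        also have "\<dots> < m * (s i - 1) + m" using qm q(2) by simp
        also have "\<dots> = m * s i" using si by (cases "s i") auto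
        finally show ?thesis .
      qed
      then have es: "e < s i" by simp
      have e0: "0 < e" using nz e by (cases e) auto
      have "s i - e \<in> {1..n}" using es si by auto
      then obtain i' where i': "i' \<in> {1..n}" "s i' = s i - e" by (rule permutes_preimage[OF s])
      have "?c i' = 0" using less.IH[of "s i'"] i' e0 es v by auto
      then have "?b i' = m * (s i - e - 1) + q - 1" using sum[of i'] i' by simp
      moreover have "?b i = m * (s i - e - 1) + q - 1"
      proof -
        have "s i - 1 = (s i - e - 1) + e" using es e0 by simp
        then have "m * (s i - 1) = m * (s i - e - 1) + m * e" by (metis distrib_left)
        then show ?thesis using sum[of i] i e q(2) by simp
      qed
      ultimately have "i = i'" using inj_onD[OF inj _ i i'(1)] by simp
      then show False using i' e0 es by simp
    qed
  qed
  show ?thesis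
  proof (rule poly_mapping_eqI)
    fix i show "?c i = Poly_Mapping.lookup 0 i"
      using c0[of "s i"] sum[of i] by (cases "i \<in> {1..n}") auto
  qed
qed

lemma div_facts:
  fixes m p :: nat
  assumes "1 \<le> m" "p dvd m"
  shows "m div p dvd m" "1 \<le> m div p"
proof -
  show "m div p dvd m" using assms by (metis dvd_div_mult_self dvd_triv_left)
  have "m div p \<noteq> 0" using assms by (metis dvd_div_eq_0_iff not_one_le_zero)
  then show "1 \<le> m div p" by simp
qed

context
  fixes K :: "complex set" and m p n :: nat
  assumes K: "subfield K (class_ring :: complex ring)" and roots: "\<forall>z. z ^ m = 1 \<longrightarrow> z \<in> K"
    and m: "1 \<le> m" and p: "p dvd m"
begin

text \<open>
  If two exponents of \<open>b\<close> agree, the summands are symmetric under exchanging their positions and cancel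
  in pairs. If all exponents are distinct, only the constant term of \<open>f\<close> could contribute, and it is zero.
\<close>

lemma alt_coeff_monom_times_invariant:
  assumes f: "f \<in> mpolys K n" and inv: "invariant K n (G_group K m p n) f"
    and hom: "homogeneous d f" "0 < d"
  shows "alt_coeff m (m div p) n (Poly_Mapping.single b 1 * f) = 0"
proof (cases "inj_on (Poly_Mapping.lookup b) {1..n}")
  case True
  have "Poly_Mapping.lookup (Poly_Mapping.single b 1 * f) (stair m (m div p) n s) = 0"
    if s: "s permutes {1..n}" for s
  proof (rule ccontr)
    let ?c = "stair m (m div p) n s - b"
    assume "Poly_Mapping.lookup (Poly_Mapping.single b 1 * f) (stair m (m div p) n s) \<noteq> 0"
    then have dvd: "monom_dvd b (stair m (m div p) n s)" and c: "?c \<in> Poly_Mapping.keys f"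
      by (simp_all add: lookup_single_times in_keys_iff split: if_splits)
    then have bc: "b + ?c = stair m (m div p) n s" by (auto simp: monom_dvd_def)
    have "?c = 0"
      by (rule stair_minus_eq_0[OF div_facts[OF m p] m s bc True])
        (rule keys_invariant_cong[OF K roots m p f inv c] keys_invariant_dvd[OF K roots m p f inv c]; assumption)+
    then have "monom_deg 0 = d" using c hom(1) by (simp add: homogeneous_def)
    then show False using hom(2) by (simp add: monom_deg_def)
  qed
  then show ?thesis by (simp add: alt_coeff_def)
next
  case False
  then obtain i j where ij: "i \<in> {1..n}" "j \<in> {1..n}" "i \<noteq> j"
    and b: "Poly_Mapping.lookup b i = Poly_Mapping.lookup b j"
    by (auto simp: inj_on_def)
  let ?t = "transpose i j" and ?k = "Poly_Mapping.map_key (transpose i j) :: monom \<Rightarrow> monom"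
  have t: "?t permutes {1..n}" using ij by (intro permutes_swap_id)
  have kb: "?k b = b"
    by (rule poly_mapping_eqI) (simp add: lookup_map_key_transpose transpose_def b)
  show ?thesis
    unfolding alt_coeff_def
  proof (rule alternating_sum_eq_0[OF _ ij])
    fix s assume s: "s permutes {1..n}"
    let ?a = "stair m (m div p) n s"
    have ka: "stair m (m div p) n (s \<circ> ?t) = ?k ?a"
      using permutes_in_image[OF t]
      by (intro poly_mapping_eqI) (simp add: lookup_map_key_transpose lookup_stair del: atLeastAtMost_iff)
    have dvd: "monom_dvd b (?k ?a) \<longleftrightarrow> monom_dvd b ?a"
      unfolding monom_dvd_iff lookup_map_key_transpose
      by (metis kb lookup_map_key_transpose transpose_involutory)
    have "?k ?a - b = ?k (?a - b)"
      by (rule poly_mapping_eqI) (metis kb lookup_map_key_transpose lookup_minus)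
    then show "Poly_Mapping.lookup (Poly_Mapping.single b 1 * f) (stair m (m div p) n (s \<circ> ?t)) =
        Poly_Mapping.lookup (Poly_Mapping.single b 1 * f) ?a"
      unfolding ka lookup_single_times dvd
      using lookup_invariant_transpose[OF K roots m p f inv ij(1,2)] by simp
  qed simp
qed

lemma alt_coeff_times_invariant:
  assumes f: "f \<in> mpolys K n" and inv: "invariant K n (G_group K m p n) f"
    and hom: "homogeneous d f" "0 < d"
  shows "alt_coeff m (m div p) n (g * f) = 0"
proof -
  have "g * f = (\<Sum>a\<in>Poly_Mapping.keys g. Poly_Mapping.single 0 (Poly_Mapping.lookup g a) *
      (Poly_Mapping.single a 1 * f))"
    by (subst mpoly_eq_sum_single[of g]) (simp add: sum_distrib_right mult.assoc)
  then show ?thesis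
    by (simp add: alt_coeff_sum alt_coeff_scale alt_coeff_monom_times_invariant[OF assms])
qed

lemma alt_coeff_times_invariant_ideal:
  assumes "f \<in> invariant_ideal K n (G_group K m p n)"
  shows "alt_coeff m (m div p) n (g * f) = 0"
proof -
  let ?J = "{f \<in> mpolys K n. \<forall>g. alt_coeff m (m div p) n (g * f) = 0}"
  have "ideal ?J (mpoly_ring K n)"
  proof (rule ideal_mpoly_ringI[OF K])
    show "f + g \<in> ?J" if "f \<in> ?J" "g \<in> ?J" for f g
      using that mpolys_add[OF K, of f n g] by (simp add: distrib_left alt_coeff_add)
    show "g * f \<in> ?J" if "f \<in> ?J" "g \<in> mpolys K n" for f g
      using that mpolys_mult[OF K, of g n f] by (simp flip: mult.assoc)
  qed (auto simp: mpolys_zero[OF K] alt_coeff_zero)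
  then have "invariant_ideal K n (G_group K m p n) \<subseteq> ?J"
    unfolding invariant_ideal_def
  proof (rule Idl_minimal[OF K], safe)
    fix f d g assume "f \<in> mpolys K n" "invariant K n (G_group K m p n) f" "(0::nat) < d" "homogeneous d f"
    then show "alt_coeff m (m div p) n (g * f) = 0" by (intro alt_coeff_times_invariant)
  qed
  then show ?thesis using assms by blast
qed

end

section \<open>Lead monomials of the ideal\<close>

text \<open>
  The cycle \<open>1 \<mapsto> 2 \<mapsto> \<dots> \<mapsto> k \<mapsto> 1\<close>. It puts the least staircase value at position \<open>k\<close> and keeps the
  others in increasing order.
\<close>

definition cycle_up :: "nat \<Rightarrow> nat \<Rightarrow> nat" where
  "cycle_up k i = (if i \<in> {1..k} then if i = k then 1 else Suc i else i)"

lemma cycle_up_permutes: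
  assumes "k \<in> {1..n}"
  shows "cycle_up k permutes {1..n}"
proof (rule bij_imp_permutes)
  have "inj_on (cycle_up k) {1..n}"
  proof (rule inj_onI)
    fix x y assume xy: "x \<in> {1..n}" "y \<in> {1..n}" "cycle_up k x = cycle_up k y"
    show "x = y"
      by (cases "x < k"; cases "y < k"; cases "x = k"; cases "y = k")
        (use xy in \<open>simp_all add: cycle_up_def\<close>)
  qed
  moreover have "cycle_up k ` {1..n} \<subseteq> {1..n}"
    using assms by (auto simp: cycle_up_def)
  ultimately show "bij_betw (cycle_up k) {1..n} {1..n}"
    by (simp add: bij_betw_def endo_inj_surj)
qed (use assms in \<open>auto simp: cycle_up_def\<close>)

context
  fixes m n :: nat
  assumes m: "1 \<le> m"
begin

lemma Suc_mult_le_iff: "m * (x - 1) + q - 1 = m * (y - 1) + q - 1 \<longleftrightarrow> x = y"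
  if "1 \<le> x" "1 \<le> y" "1 \<le> q" for x y q
proof -
  have "u + q - 1 = v + q - 1 \<longleftrightarrow> u = v" for u v
    using that(3) by auto
  then have "m * (x - 1) + q - 1 = m * (y - 1) + q - 1 \<longleftrightarrow> x - 1 = y - 1"
    using m by simp
  then show ?thesis using that by auto
qed

lemma stair_inj:
  assumes q: "1 \<le> q" and s: "s permutes {1..n}" and t: "t permutes {1..n}"
    and eq: "stair m q n s = stair m q n t"
  shows "s = t"
proof
  fix i
  show "s i = t i"
  proof (cases "i \<in> {1..n}")
    case True
    then have "s i \<in> {1..n}" "t i \<in> {1..n}"
      using permutes_in_image[OF s] permutes_in_image[OF t] by blast+
    moreover have "m * (s i - 1) + q - 1 = m * (t i - 1) + q - 1"
      using arg_cong[OF eq, of "\<lambda>a. Poly_Mapping.lookup a i"] True by (simp add: lookup_stair)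
    ultimately show ?thesis using Suc_mult_le_iff q by simp
  next
    case False
    then show ?thesis using permutes_not_in[OF s] permutes_not_in[OF t] by simp
  qed
qed

text \<open>
  At the first position \<open>i\<close> where the two staircases differ, \<open>s\<close> has to take a smaller value that is not used
  before \<open>i\<close>. Along an increasing staircase there is none, except the least value as long as it has not
  been placed, which for this cycle happens at position \<open>k\<close>.
\<close>

lemma stair_less_cycle_up:
  assumes q: "1 \<le> q" and k: "k \<in> {1..n}" and s: "s permutes {1..n}"
    and less: "stair m q n s < stair m q n (cycle_up k)"
  obtains i where "i \<in> {1..n}" "i < k" "s i = 1"
proof -
  let ?t = "cycle_up k"
  have t: "?t permutes {1..n}" using k by (rule cycle_up_permutes)
  obtain i where i: "Poly_Mapping.lookup (stair m q n s) i < Poly_Mapping.lookup (stair m q n ?t) i"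
    and eq: "\<And>j. j < i \<Longrightarrow> Poly_Mapping.lookup (stair m q n s) j = Poly_Mapping.lookup (stair m q n ?t) j"
    using less unfolding monom_less_iff by blast
  have i_n: "i \<in> {1..n}" using i by (auto simp: lookup_stair split: if_splits)
  have image: "s j \<in> {1..n}" "?t j \<in> {1..n}" if "j \<in> {1..n}" for j
    using that permutes_in_image[OF s] permutes_in_image[OF t] by blast+
  have s_eq: "s j = ?t j" if j: "j \<in> {1..n}" "j < i" for j
    using eq[OF j(2)] j image[OF j(1)] Suc_mult_le_iff[OF _ _ q] by (simp add: lookup_stair)
  have "s i < ?t i"
  proof (rule ccontr)
    assume "\<not> s i < ?t i"
    then have "m * (?t i - 1) \<le> m * (s i - 1)" by (intro mult_le_mono2) simp
    then have "m * (?t i - 1) + q - 1 \<le> m * (s i - 1) + q - 1" by (intro diff_le_mono add_right_mono)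
    moreover have "m * (s i - 1) + q - 1 < m * (?t i - 1) + q - 1"
      using i i_n unfolding lookup_stair by (simp only: if_True)
    ultimately show False by (simp only: linorder_not_less)
  qed
  have fresh: "s i \<noteq> ?t j" if "j \<in> {1..n}" "j < i" for j
    using s_eq[OF that] inj_eq[OF permutes_inj[OF s], of i j] that(2) by simp
  consider "i < k" | "i = k" | "k < i" by linarith
  then show thesis
  proof cases
    case 1
    then have "?t i = Suc i" using i_n by (simp add: cycle_up_def)
    then have le: "s i \<le> i" using \<open>s i < ?t i\<close> by simp
    have "s i = 1"
    proof (rule ccontr)
      assume "s i \<noteq> 1"
      then have "s i - 1 \<in> {1..n}" "s i - 1 < i" "Suc (s i - 1) = s i" "s i - 1 < k"
        using le image[OF i_n] 1 by auto
      then show False using fresh[of "s i - 1"] by (simp add: cycle_up_def)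
    qed
    then show thesis using that i_n 1 by blast
  next
    case 2
    then show thesis using \<open>s i < ?t i\<close> image(1)[OF i_n] i_n by (simp add: cycle_up_def)
  next
    case 3
    then have "s i < i" using \<open>s i < ?t i\<close> by (simp add: cycle_up_def)
    obtain j where j: "j \<in> {1..n}" "?t j = s i"
      using permutes_preimage[OF t image(1)[OF i_n]] by blast
    have "j < i"
    proof (rule ccontr)
      assume "\<not> j < i"
      then have "?t j = j" using 3 by (simp add: cycle_up_def)
      then show False using j \<open>s i < i\<close> \<open>\<not> j < i\<close> by simp
    qed
    then show thesis using fresh[OF j(1)] j(2) by simp
  qed
qed

end

text \<open>
  Suppose the lead monomial \<open>a\<close> satisfies neither condition, and let \<open>k\<close> be the last position with
  \<open>a\<^sub>k < q\<close>. Then \<open>a\<close> divides the staircase permuted by \<open>cycle_up k\<close>; let \<open>b\<close> be the quotient. Among the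
  monomials of \<open>x\<^sup>b f\<close>, this staircase is the largest. A smaller permuted staircase has the value \<open>q - 1\<close> at
  some \<open>i < k\<close>, whereas \<open>b\<^sub>i = m i + q - 1 - a\<^sub>i \<ge> q\<close>, so it is not a multiple of \<open>x\<^sup>b\<close>. Hence
  the alternating functional takes on \<open>x\<^sup>b f\<close> the value of the lead coefficient of \<open>f\<close> up to sign, and this
  contradicts its vanishing on the ideal.
\<close>

lemma invariant_ideal_lead_monom:
  assumes K: "subfield K (class_ring :: complex ring)" and roots: "\<forall>z. z ^ m = 1 \<longrightarrow> z \<in> K"
    and m: "1 \<le> m" and p: "p dvd m" and n: "1 \<le> n" and f: "f \<in> invariant_ideal K n (G_group K m p n)" "f \<noteq> 0"
    and f_mp: "f \<in> mpolys K n"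
  defines "a \<equiv> Poly_Mapping.lookup (lead_monom f)" and "q \<equiv> m div p"
  shows "(\<exists>j\<in>{1..n-1}. m * j \<le> a j) \<or>
    (\<exists>j\<in>{1..n}. m * (j - 1) + q \<le> a j \<and> (\<forall>i\<in>{j<..n}. q \<le> a i))"
proof (rule ccontr)
  assume neg: "\<not> ?thesis"
  then have small: "a j < m * j" if "j \<in> {1..n-1}" for j
    using that by (auto simp: not_le)
  have step: "(\<exists>i\<in>{j<..n}. a i < q) \<or> a j < m * (j - 1) + q" if "j \<in> {1..n}" for j
    using neg that by (auto simp: not_le)
  have q: "1 \<le> q" unfolding q_def by (rule div_facts(2)[OF m p])
  define S where "S = {i \<in> {1..n}. a i < q}"
  \<comment> \<open>For \<open>j = 1\<close> the bound \<open>m (j - 1) + q\<close> is \<open>q\<close> itself, so position 1 qualifies if no later one does.\<close>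
  have "S \<noteq> {}" using step[of 1] n by (auto simp: S_def)
  define k where "k = Max S"
  have fin: "finite S" by (simp add: S_def)
  have "k \<in> S" unfolding k_def using fin \<open>S \<noteq> {}\<close> by (rule Max_in)
  then have k: "k \<in> {1..n}" "a k < q" by (auto simp: S_def)
  have above: "a j < m * (j - 1) + q" if j: "j \<in> {1..n}" "k < j" for j
  proof -
    have "\<not> (\<exists>i\<in>{j<..n}. a i < q)"
    proof
      assume "\<exists>i\<in>{j<..n}. a i < q"
      then obtain i where "i \<in> S" "j < i" using j by (auto simp: S_def)
      then show False using Max_ge[OF fin, of i] j(2) by (simp add: k_def)
    qed
    then show ?thesis using step[OF j(1)] by blast
  qed
  let ?t = "cycle_up k"
  have t: "?t permutes {1..n}" using k(1) by (rule cycle_up_permutes)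
  have keys_a: "Poly_Mapping.keys (lead_monom f) \<subseteq> {1..n}"
    by (rule keys_mpolys[OF K f_mp lead_monom_in_keys[OF f(2)]])
  have dvd: "monom_dvd (lead_monom f) (stair m q n ?t)"
    unfolding monom_dvd_iff
  proof
    fix i
    consider "i \<notin> {1..n}" | "i \<in> {1..n}" "i < k" | "i = k" | "i \<in> {1..n}" "k < i" by linarith
    then show "Poly_Mapping.lookup (lead_monom f) i \<le> Poly_Mapping.lookup (stair m q n ?t) i"
    proof cases
      case 1
      then have "Poly_Mapping.lookup (lead_monom f) i = 0" using keys_a by (auto simp: in_keys_iff)
      then show ?thesis by simp
    next
      case 2
      then have "i \<in> {1..n-1}" using k by auto
      from small[OF this] show ?thesis using 2 by (simp add: lookup_stair a_def cycle_up_def)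
    next
      case 3
      then show ?thesis using k by (simp add: lookup_stair a_def cycle_up_def)
    next
      case 4
      then show ?thesis using above[OF 4] by (simp add: lookup_stair a_def cycle_up_def)
    qed
  qed
  then obtain b where b: "stair m q n ?t = lead_monom f + b" by (auto simp: monom_dvd_def)
  let ?h = "Poly_Mapping.single b 1 * f"
  have zero: "Poly_Mapping.lookup ?h (stair m q n s) = 0" if s: "s permutes {1..n}" "s \<noteq> ?t" for s
  proof (rule ccontr)
    assume "Poly_Mapping.lookup ?h (stair m q n s) \<noteq> 0"
    then have "monom_dvd b (stair m q n s)" and c: "stair m q n s - b \<in> Poly_Mapping.keys f"
      by (simp_all add: lookup_single_times in_keys_iff split: if_splits)
    then obtain c where c: "stair m q n s = b + c" "c \<in> Poly_Mapping.keys f"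
      by (auto simp: monom_dvd_def)
    have "stair m q n s \<le> stair m q n ?t"
      unfolding b c(1) using le_lead_monom[OF c(2)] by (simp add: add.commute add_right_mono)
    moreover have "stair m q n s \<noteq> stair m q n ?t" using stair_inj[OF m q s(1) t] s(2) by blast
    ultimately have "stair m q n s < stair m q n ?t" by simp
    then obtain i where i: "i \<in> {1..n}" "i < k" "s i = 1"
      by (rule stair_less_cycle_up[OF m q k(1) s(1)])
    have "Poly_Mapping.lookup b i + Poly_Mapping.lookup c i = q - 1"
      using arg_cong[OF c(1), of "\<lambda>a. Poly_Mapping.lookup a i"] i by (simp add: lookup_stair lookup_add)
    moreover have "a i + Poly_Mapping.lookup b i = m * i + q - 1"
      using arg_cong[OF b, of "\<lambda>a. Poly_Mapping.lookup a i"] i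
      by (simp add: lookup_stair lookup_add a_def cycle_up_def)
    moreover have "a i < m * i" using small[of i] i k by auto
    ultimately show False using q by linarith
  qed
  have "alt_coeff m q n ?h = of_int (sign ?t) * Poly_Mapping.lookup ?h (stair m q n ?t)"
  proof -
    have "alt_coeff m q n ?h = (\<Sum>s\<in>{?t}. of_int (sign s) * Poly_Mapping.lookup ?h (stair m q n s))"
      unfolding alt_coeff_def using t zero finite_permutations[of "{1..n}"] by (intro sum.mono_neutral_right) auto
    then show ?thesis by simp
  qed
  moreover have "Poly_Mapping.lookup ?h (stair m q n ?t) = Poly_Mapping.lookup f (lead_monom f)"
    unfolding lookup_single_times b by (simp add: monom_dvd_iff lookup_add)
  moreover have "Poly_Mapping.lookup f (lead_monom f) \<noteq> 0"
    using lead_monom_in_keys[OF f(2)] by (simp add: in_keys_iff)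
  ultimately show False
    using alt_coeff_times_invariant_ideal[OF K roots m p f(1), of "Poly_Mapping.single b 1"]
    by (simp add: q_def)
qed

section \<open>The generators\<close>

lemma prod_single: "(\<Prod>i\<in>S. Poly_Mapping.single (e i) (1::complex)) = Poly_Mapping.single (\<Sum>i\<in>S. (e i :: monom)) 1"
  by (induction S rule: infinite_finite_induct) (auto simp: mult_single)

lemma prod_var_power: "(\<Prod>i\<in>S. var i ^ e i) = Poly_Mapping.single (expvec S e) 1"
  by (simp add: var_power prod_single expvec_def)

lemma prod_mset_eq_prod:
  fixes y :: "nat \<Rightarrow> 'a::comm_semiring_1"
  assumes "finite S" "set_mset M \<subseteq> S"
  shows "(\<Prod>i\<in>#M. y i) = (\<Prod>i\<in>S. y i ^ count M i)"
  unfolding image_prod_mset_multiplicity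
  using assms by (intro prod.mono_neutral_left) (auto simp: not_in_iff)

definition msets :: "nat \<Rightarrow> nat set \<Rightarrow> nat multiset set" where
  "msets k S = {M. set_mset M \<subseteq> S \<and> size M = k}"

text \<open>
  Both families of generators have this form: the first with \<open>r = 0\<close>, \<open>k = j\<close>, the second with
  \<open>r = m/p\<close>, \<open>k = j - 1\<close>. Their monomials are indexed by the multisets of size \<open>k\<close>.
\<close>

definition gen :: "nat \<Rightarrow> nat \<Rightarrow> nat \<Rightarrow> nat \<Rightarrow> nat \<Rightarrow> mpoly" where
  "gen m n r j k = complete_hom k {j..n} (\<lambda>i. var i ^ m) * (\<Prod>i=j..n. var i) ^ r"

definition gen_exp :: "nat \<Rightarrow> nat \<Rightarrow> nat \<Rightarrow> nat \<Rightarrow> nat multiset \<Rightarrow> monom" where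
  "gen_exp m n r j M = expvec {j..n} (\<lambda>i. m * count M i + r)"

lemma lookup_gen_exp:
  "Poly_Mapping.lookup (gen_exp m n r j M) i = (if i \<in> {j..n} then m * count M i + r else 0)"
  by (simp add: gen_exp_def lookup_expvec)

lemma finite_msets: "finite S \<Longrightarrow> finite (msets k S)"
  unfolding msets_def by (rule finite_multisets_of_size)

lemma gen_eq_sum: "gen m n r j k = (\<Sum>M\<in>msets k {j..n}. Poly_Mapping.single (gen_exp m n r j M) 1)"
  unfolding gen_def complete_hom_def msets_def[symmetric] sum_distrib_right
proof (rule sum.cong)
  fix M assume "M \<in> msets k {j..n}"
  then have "(\<Prod>i\<in>#M. var i ^ m) = (\<Prod>i\<in>{j..n}. (var i ^ m) ^ count M i)"
    by (intro prod_mset_eq_prod) (auto simp: msets_def)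
  then have "(\<Prod>i\<in>#M. var i ^ m) * (\<Prod>i=j..n. var i) ^ r =
      (\<Prod>i\<in>{j..n}. var i ^ (m * count M i) * var i ^ r)"
    by (simp add: prod.distrib prod_power_distrib power_mult)
  then show "(\<Prod>i\<in>#M. var i ^ m) * (\<Prod>i=j..n. var i) ^ r = Poly_Mapping.single (gen_exp m n r j M) 1"
    by (simp only: power_add[symmetric] prod_var_power gen_exp_def)
qed simp

lemma inj_on_gen_exp:
  assumes "1 \<le> m"
  shows "inj_on (gen_exp m n r j) (msets k {j..n})"
proof (rule inj_onI, rule multiset_eqI)
  fix M N i assume MN: "M \<in> msets k {j..n}" "N \<in> msets k {j..n}" "gen_exp m n r j M = gen_exp m n r j N"
  show "count M i = count N i"
  proof (cases "i \<in> {j..n}")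
    case True
    then show ?thesis
      using arg_cong[OF MN(3), of "\<lambda>a. Poly_Mapping.lookup a i"] assms by (simp add: lookup_gen_exp)
  next
    case False
    then have "i \<notin># M" "i \<notin># N" using MN by (auto simp: msets_def)
    then show ?thesis by (simp add: not_in_iff)
  qed
qed

lemma lookup_gen:
  assumes "1 \<le> m"
  shows "Poly_Mapping.lookup (gen m n r j k) a = (if a \<in> gen_exp m n r j ` msets k {j..n} then 1 else 0)"
proof -
  have "Poly_Mapping.lookup (gen m n r j k) a =
      (\<Sum>M\<in>msets k {j..n}. Poly_Mapping.lookup (Poly_Mapping.single (gen_exp m n r j M) 1) a)"
    by (simp add: gen_eq_sum lookup_sum)
  also have "\<dots> = (\<Sum>b\<in>gen_exp m n r j ` msets k {j..n}. Poly_Mapping.lookup (Poly_Mapping.single b 1) a)"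
    by (simp add: sum.reindex[OF inj_on_gen_exp[OF assms]])
  also have "\<dots> = (if a \<in> gen_exp m n r j ` msets k {j..n} then 1 else 0)"
    by (simp add: lookup_single when_def finite_msets)
  finally show ?thesis .
qed

lemma keys_gen:
  assumes "1 \<le> m"
  shows "Poly_Mapping.keys (gen m n r j k) = gen_exp m n r j ` msets k {j..n}"
  by (auto simp: in_keys_iff lookup_gen[OF assms] split: if_splits)

lemma count_eq_size_imp_replicate:
  assumes "size M \<le> count M x"
  shows "M = replicate_mset (size M) x"
proof (rule ccontr)
  assume "M \<noteq> replicate_mset (size M) x"
  then have "replicate_mset (size M) x \<subset># M"
    using assms by (simp add: subset_mset_def count_le_replicate_mset_subset_eq)
  from mset_subset_size[OF this] show False by simp
qed

text \<open>
  As \<open>x\<^sub>j\<close> is the largest variable that occurs, the largest monomial takes all \<open>k\<close> factors equal to \<open>x\<^sub>j\<^sup>m\<close>.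
\<close>

lemma gen_lead:
  assumes m: "1 \<le> m" and j: "j \<le> n"
  shows "lead_monom (gen m n r j k) = gen_exp m n r j (replicate_mset k j)"
    and "lead_coef (gen m n r j k) = 1"
proof -
  have "replicate_mset k j \<in> msets k {j..n}" using j by (simp add: msets_def)
  then have in_keys: "gen_exp m n r j (replicate_mset k j) \<in> Poly_Mapping.keys (gen m n r j k)"
    by (simp add: keys_gen[OF m])
  have "gen_exp m n r j M \<le> gen_exp m n r j (replicate_mset k j)" if M: "M \<in> msets k {j..n}" for M
  proof (cases "M = replicate_mset k j")
    case False
    have "size M = k" using M by (simp add: msets_def)
    then have "\<not> size M \<le> count M j" using False count_eq_size_imp_replicate[of M j] by blast
    then have "count M j < k" using \<open>size M = k\<close> by simp
    then have "gen_exp m n r j M < gen_exp m n r j (replicate_mset k j)"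
      unfolding monom_less_iff using m j by (intro exI[of _ j]) (simp add: lookup_gen_exp)
    then show ?thesis by simp
  qed simp
  then show lead: "lead_monom (gen m n r j k) = gen_exp m n r j (replicate_mset k j)"
    using in_keys by (intro lead_monom_eqI) (auto simp: keys_gen[OF m])
  show "lead_coef (gen m n r j k) = 1"
    using in_keys unfolding lead_coef_def lead by (simp add: lookup_gen[OF m] keys_gen[OF m])
qed

lemma lookup_lead_gen:
  assumes "1 \<le> m" "j \<le> n"
  shows "Poly_Mapping.lookup (lead_monom (gen m n r j k)) i =
    (if i = j then m * k + r else if i \<in> {j..n} then r else 0)"
  using assms by (simp add: gen_lead lookup_gen_exp)

lemma keys_gen_bound:
  assumes "1 \<le> m" "a \<in> Poly_Mapping.keys (gen m n r j k)"
  shows "Poly_Mapping.lookup a i \<le> (if i \<in> {j..n} then m * k + r else 0)"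
proof -
  obtain M where "M \<in> msets k {j..n}" "a = gen_exp m n r j M"
    using assms keys_gen by blast
  moreover have "count M i \<le> size M" by (rule count_le_size)
  ultimately show ?thesis by (simp add: lookup_gen_exp msets_def)
qed

text \<open>
  The monomials are split according to whether they contain \<open>y x\<close>.
\<close>

lemma complete_hom_Suc_insert:
  assumes S: "finite S" "x \<notin> S"
  shows "complete_hom (Suc k) (insert x S) y = complete_hom (Suc k) S y + y x * complete_hom k (insert x S) y"
proof -
  have split: "msets (Suc k) (insert x S) = msets (Suc k) S \<union> add_mset x ` msets k (insert x S)"
  proof (rule equalityI; rule subsetI)
    fix M assume M: "M \<in> msets (Suc k) (insert x S)"
    show "M \<in> msets (Suc k) S \<union> add_mset x ` msets k (insert x S)"
    proof (cases "x \<in># M")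
      case True
      then obtain N where "M = add_mset x N" by (metis mset_add)
      then show ?thesis using M by (auto simp: msets_def)
    next
      case False
      then show ?thesis using M by (auto simp: msets_def)
    qed
  qed (auto simp: msets_def)
  have "complete_hom (Suc k) (insert x S) y =
      (\<Sum>M\<in>msets (Suc k) S. \<Prod>i\<in>#M. y i) + (\<Sum>M\<in>add_mset x ` msets k (insert x S). \<Prod>i\<in>#M. y i)"
    unfolding complete_hom_def msets_def[symmetric] split
    using S finite_msets[of S "Suc k"] finite_msets[of "insert x S" k]
    by (intro sum.union_disjoint finite_imageI) (auto simp: msets_def)
  also have "(\<Sum>M\<in>add_mset x ` msets k (insert x S). \<Prod>i\<in>#M. y i) = (\<Sum>M\<in>msets k (insert x S). y x * (\<Prod>i\<in>#M. y i))"
    by (subst sum.reindex) (simp_all add: inj_on_def)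
  finally show ?thesis
    by (simp add: complete_hom_def msets_def sum_distrib_left)
qed

lemma complete_hom_permute:
  assumes t: "t permutes S"
  shows "complete_hom k S (\<lambda>i. y (t i)) = complete_hom k S y"
proof -
  let ?t' = "inv_into UNIV t"
  have t': "?t' permutes S" using t by (rule permutes_inv)
  have cancel: "t (?t' i) = i" "?t' (t i) = i" for i using permutes_inverses[OF t] by auto
  have image: "image_mset s M \<in> msets k S" if "s permutes S" "M \<in> msets k S" for s M
    using that permutes_in_image[OF that(1)] by (auto simp: msets_def)
  show ?thesis
    unfolding complete_hom_def msets_def[symmetric]
    by (rule sum.reindex_bij_witness[of _ "image_mset ?t'" "image_mset t"])
      (simp_all add: image[OF t] image[OF t'] multiset.map_comp cancel o_def)
qed

lemma invariant_ideal_generators: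
  "{f \<in> mpolys K n. (\<exists>d>0. homogeneous d f) \<and> invariant K n G f} \<subseteq> mpolys K n"
  by blast

lemma ideal_invariant_ideal:
  assumes "subfield K (class_ring :: complex ring)"
  shows "ideal (invariant_ideal K n G) (mpoly_ring K n)"
  unfolding invariant_ideal_def by (rule ideal_Idl[OF assms invariant_ideal_generators])

context
  fixes K :: "complex set" and m p n :: nat
  assumes K: "subfield K (class_ring :: complex ring)" and m: "1 \<le> m"
begin

lemma gen_mpolys:
  assumes "1 \<le> j"
  shows "gen m n r j k \<in> mpolys K n"
proof -
  have "Poly_Mapping.keys (gen_exp m n r j M) \<subseteq> {1..n}" for M
    using assms by (auto simp: in_keys_iff lookup_gen_exp split: if_splits)
  then show ?thesis
    unfolding gen_eq_sum by (intro mpolys_sum[OF K] mpolys_single[OF K] subfield_one[OF K])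
qed

lemma gen_homogeneous: "homogeneous (m * k + r * n) (gen m n r 1 k)"
  unfolding homogeneous_def keys_gen[OF m]
proof
  fix a assume "a \<in> gen_exp m n r 1 ` msets k {1..n}"
  then obtain M where M: "M \<in> msets k {1..n}" and a: "a = gen_exp m n r 1 M" by blast
  have "Poly_Mapping.keys a \<subseteq> {1..n}"
    unfolding a by (auto simp: in_keys_iff lookup_gen_exp split: if_splits)
  then have "monom_deg a = (\<Sum>i\<in>{1..n}. Poly_Mapping.lookup a i)"
    unfolding monom_deg_def by (intro sum.mono_neutral_left) (auto simp: in_keys_iff)
  also have "\<dots> = (\<Sum>i\<in>{1..n}. m * count M i + r)"
    unfolding a by (rule sum.cong) (simp_all add: lookup_gen_exp)
  also have "\<dots> = m * (\<Sum>i\<in>{1..n}. count M i) + r * n"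
    by (simp add: sum.distrib sum_distrib_left mult.commute)
  also have "(\<Sum>i\<in>{1..n}. count M i) = size M"
    unfolding size_multiset_overloaded_eq
    using M by (intro sum.mono_neutral_right) (auto simp: msets_def not_in_iff)
  finally show "monom_deg a = m * k + r * n" using M by (simp add: msets_def)
qed

lemma gen_eval:
  "mpoly_eval (gen m n r 1 k) (coords n v) = complete_hom k {1..n} (\<lambda>i. v i ^ m) * (\<Prod>i=1..n. v i) ^ r"
proof -
  have "mpoly_eval (gen m n r 1 k) (coords n v) =
      (\<Sum>a\<in>gen_exp m n r 1 ` msets k {1..n}. \<Prod>i\<in>{1..n}. v i ^ Poly_Mapping.lookup a i)"
    unfolding mpoly_eval_coords[OF gen_mpolys[OF order_refl]] keys_gen[OF m]
    by (rule sum.cong) (simp_all add: lookup_gen[OF m])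
  also have "\<dots> = (\<Sum>M\<in>msets k {1..n}. \<Prod>i\<in>{1..n}. v i ^ Poly_Mapping.lookup (gen_exp m n r 1 M) i)"
    by (simp add: sum.reindex[OF inj_on_gen_exp[OF m]])
  also have "\<dots> = (\<Sum>M\<in>msets k {1..n}. (\<Prod>i\<in>#M. v i ^ m) * (\<Prod>i=1..n. v i) ^ r)"
  proof (rule sum.cong)
    fix M assume M: "M \<in> msets k {1..n}"
    have "(\<Prod>i\<in>#M. v i ^ m) = (\<Prod>i\<in>{1..n}. (v i ^ m) ^ count M i)"
      using M by (intro prod_mset_eq_prod) (auto simp: msets_def)
    moreover have "(\<Prod>i\<in>{1..n}. v i ^ Poly_Mapping.lookup (gen_exp m n r 1 M) i) =
        (\<Prod>i\<in>{1..n}. (v i ^ m) ^ count M i * v i ^ r)"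
      by (rule prod.cong) (simp_all add: lookup_gen_exp power_add power_mult)
    ultimately show "(\<Prod>i\<in>{1..n}. v i ^ Poly_Mapping.lookup (gen_exp m n r 1 M) i) =
        (\<Prod>i\<in>#M. v i ^ m) * (\<Prod>i=1..n. v i) ^ r"
      by (simp add: prod.distrib prod_power_distrib)
  qed simp
  finally show ?thesis
    by (simp add: complete_hom_def msets_def sum_distrib_right)
qed

lemma gen_invariant:
  assumes "r = 0 \<or> r = m div p"
  shows "invariant K n (G_group K m p n) (gen m n r 1 k)"
proof (rule invariant_G_groupI[OF m])
  fix d :: "nat \<Rightarrow> complex" and t v
  assume t: "t permutes {1..n}" and d: "\<And>i. i \<in> {1..n} \<Longrightarrow> d i ^ m = 1"
    and prod: "(\<Prod>i\<in>{1..n}. d i) ^ (m div p) = 1"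
  have "complete_hom k {1..n} (\<lambda>i. (d i * v (t i)) ^ m) = complete_hom k {1..n} (\<lambda>i. v (t i) ^ m)"
    unfolding complete_hom_def
    by (intro sum.cong refl arg_cong[of _ _ prod_mset] image_mset_cong)
      (auto simp: power_mult_distrib d subset_iff)
  also have "\<dots> = complete_hom k {1..n} (\<lambda>i. v i ^ m)"
    using complete_hom_permute[OF t, of k "\<lambda>i. v i ^ m"] .
  moreover have "(\<Prod>i=1..n. d i * v (t i)) ^ r = (\<Prod>i=1..n. v i) ^ r"
  proof -
    have "(\<Prod>i=1..n. d i) ^ r = 1" using assms prod by auto
    moreover have "(\<Prod>i=1..n. v (t i)) = (\<Prod>i=1..n. v i)"
      using prod.permute[OF t, of v] by (simp add: o_def)
    ultimately show ?thesis by (simp add: prod.distrib power_mult_distrib)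
  qed
  ultimately show "mpoly_eval (gen m n r 1 k) (coords n (\<lambda>i. d i * v (t i))) = mpoly_eval (gen m n r 1 k) (coords n v)"
    unfolding gen_eval by simp
qed

lemma gen_1_in_invariant_ideal:
  assumes "r = 0 \<or> r = m div p" "0 < m * k + r * n"
  shows "gen m n r 1 k \<in> invariant_ideal K n (G_group K m p n)"
proof -
  have "gen m n r 1 k \<in> {f \<in> mpolys K n. (\<exists>d>0. homogeneous d f) \<and> invariant K n (G_group K m p n) f}"
    using gen_mpolys[OF order_refl] gen_homogeneous gen_invariant[OF assms(1)] assms(2) by blast
  then show ?thesis
    unfolding invariant_ideal_def by (rule subsetD[OF Idl_self[OF K invariant_ideal_generators]])
qed

lemma gen_step:
  assumes "j \<le> n"
  shows "gen m n r (Suc j) (Suc k) =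
    complete_hom (Suc k) {j..n} (\<lambda>i. var i ^ m) * (\<Prod>i=Suc j..n. var i) ^ r -
    var j ^ m * complete_hom k {j..n} (\<lambda>i. var i ^ m) * (\<Prod>i=Suc j..n. var i) ^ r"
proof -
  have "insert j {Suc j..n} = {j..n}" using assms by auto
  then show ?thesis
    using complete_hom_Suc_insert[of "{Suc j..n}" j k "\<lambda>i. var i ^ m"]
    by (simp add: gen_def algebra_simps)
qed

text \<open>
  Variables are removed one at a time, starting from the symmetric polynomials in all of them:
  \<open>h\<^sub>k(y\<^bsub>j+1\<^esub>, \<dots>, y\<^sub>n) = h\<^sub>k(y\<^sub>j, \<dots>, y\<^sub>n) - y\<^sub>j h\<^bsub>k-1\<^esub>(y\<^sub>j, \<dots>, y\<^sub>n)\<close> for \<open>y\<^sub>i = x\<^sub>i\<^sup>m\<close>. The degree drops by at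
  most one in each step, so \<open>k \<ge> j\<close> suffices to stay in positive degree.
\<close>

lemma gen_0_in_invariant_ideal:
  assumes "1 \<le> j" "j \<le> n" "j \<le> k"
  shows "gen m n 0 j k \<in> invariant_ideal K n (G_group K m p n)"
  using assms
proof (induction j arbitrary: k rule: nat_induct_at_least)
  case base
  then show ?case using m by (intro gen_1_in_invariant_ideal) auto
next
  case (Suc j)
  obtain k' where k: "k = Suc k'" using Suc.prems by (cases k) auto
  note I = ideal_mpoly_ringD[OF K ideal_invariant_ideal[OF K, of n "G_group K m p n"]]
  have "gen m n 0 j k \<in> invariant_ideal K n (G_group K m p n)"
    "gen m n 0 j k' \<in> invariant_ideal K n (G_group K m p n)"
    using Suc.IH[of k] Suc.IH[of k'] Suc.prems k by auto
  moreover have "var j ^ m \<in> mpolys K n"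
    using Suc.prems Suc.hyps by (intro mpolys_power[OF K] mpolys_var[OF K]) simp
  ultimately have "gen m n 0 j k - var j ^ m * gen m n 0 j k' \<in> invariant_ideal K n (G_group K m p n)"
    by (intro I(4,5))
  moreover have "gen m n 0 (Suc j) k = gen m n 0 j k - var j ^ m * gen m n 0 j k'"
    using gen_step[of j 0 k'] Suc.prems by (simp add: k gen_def)
  ultimately show ?case by simp
qed

text \<open>
  The same recursion, multiplied by \<open>(x\<^bsub>j+1\<^esub> \<cdots> x\<^sub>n)\<^sup>q\<close>. The factor \<open>y\<^sub>j = x\<^sub>j\<^bsup>m-q\<^esup> x\<^sub>j\<^sup>q\<close> of the second term
  supplies the missing \<open>x\<^sub>j\<^sup>q\<close>. Since \<open>(x\<^sub>1 \<cdots> x\<^sub>n)\<^sup>q\<close> is itself an invariant of positive degree, the recursion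
  may start from \<open>h\<^sub>0 = 1\<close>, which gains one degree over the preceding lemma.
\<close>

lemma gen_q_in_invariant_ideal:
  assumes p: "p dvd m" and "1 \<le> j" "j \<le> n" "j \<le> Suc k"
  shows "gen m n (m div p) j k \<in> invariant_ideal K n (G_group K m p n)"
  using assms(2-)
proof (induction j arbitrary: k rule: nat_induct_at_least)
  case base
  then show ?case using m div_facts[OF m p] by (intro gen_1_in_invariant_ideal) auto
next
  case (Suc j)
  let ?q = "m div p"
  let ?P = "(\<Prod>i=Suc j..n. var i) ^ ?q"
  obtain k' where k: "k = Suc k'" using Suc.prems Suc.hyps by (cases k) auto
  note I = ideal_mpoly_ringD[OF K ideal_invariant_ideal[OF K, of n "G_group K m p n"]]
  have j: "j \<in> {1..n}" using Suc.prems Suc.hyps by simp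
  have P: "?P \<in> mpolys K n"
    by (intro mpolys_power[OF K] mpolys_prod[OF K] mpolys_var[OF K]) auto
  have V: "var j ^ (m - ?q) \<in> mpolys K n"
    by (intro mpolys_power[OF K] mpolys_var[OF K] j)
  have "gen m n 0 j k \<in> invariant_ideal K n (G_group K m p n)"
    using gen_0_in_invariant_ideal Suc.prems Suc.hyps by simp
  moreover have "gen m n ?q j k' \<in> invariant_ideal K n (G_group K m p n)"
    using Suc.IH[of k'] Suc.prems k by simp
  ultimately have "?P * gen m n 0 j k - var j ^ (m - ?q) * gen m n ?q j k' \<in> invariant_ideal K n (G_group K m p n)"
    by (intro I(4,5) P V)
  moreover have "gen m n ?q (Suc j) k = ?P * gen m n 0 j k - var j ^ (m - ?q) * gen m n ?q j k'"
  proof -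
    have "var j ^ m = var j ^ (m - ?q) * var j ^ ?q"
      by (simp add: power_add[symmetric])
    moreover have "(\<Prod>i=j..n. var i) ^ ?q = var j ^ ?q * ?P"
      using j by (simp add: prod.atLeast_Suc_atMost power_mult_distrib)
    ultimately show ?thesis
      using gen_step[of j ?q k'] j by (simp add: k gen_def algebra_simps)
  qed
  ultimately show ?case by simp
qed

end

section \<open>The reduced Groebner basis\<close>

lemma not_monom_dvdI:
  "Poly_Mapping.lookup b i < Poly_Mapping.lookup a i \<Longrightarrow> \<not> monom_dvd a b"
  by (auto simp: monom_dvd_iff not_le)

context
  fixes m n :: nat
  assumes m: "1 \<le> m"
begin

lemma gen_0_0_not_dvd:
  assumes "i \<in> {1..n}" "j \<in> {1..n}" "i \<noteq> j" "a \<in> Poly_Mapping.keys (gen m n 0 i i)"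
  shows "\<not> monom_dvd (lead_monom (gen m n 0 j j)) a"
proof (rule not_monom_dvdI[of _ j])
  have "Poly_Mapping.lookup a j \<le> (if j \<in> {i..n} then m * i + 0 else 0)"
    using keys_gen_bound[OF m assms(4)] .
  also have "\<dots> < m * j" using assms m by (cases "j \<in> {i..n}") auto
  finally show "Poly_Mapping.lookup a j < Poly_Mapping.lookup (lead_monom (gen m n 0 j j)) j"
    using assms by (simp add: lookup_lead_gen[OF m])
qed

lemma gen_0_q_not_dvd:
  assumes "i \<in> {1..n}" "j \<in> {1..n}" "q < m" "a \<in> Poly_Mapping.keys (gen m n q i (i - 1))"
  shows "\<not> monom_dvd (lead_monom (gen m n 0 j j)) a"
proof (rule not_monom_dvdI[of _ j])
  have "Poly_Mapping.lookup a j \<le> (if j \<in> {i..n} then m * (i - 1) + q else 0)"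
    using keys_gen_bound[OF m assms(4)] .
  also have "\<dots> < m * j"
  proof (cases "j \<in> {i..n}")
    case True
    have "m * (i - 1) + q < m * (i - 1) + m" using assms(3) by simp
    also have "\<dots> = m * i" using assms(1) by (cases i) auto
    also have "\<dots> \<le> m * j" using True by simp
    finally show ?thesis using True by simp
  qed (use assms m in auto)
  finally show "Poly_Mapping.lookup a j < Poly_Mapping.lookup (lead_monom (gen m n 0 j j)) j"
    using assms by (simp add: lookup_lead_gen[OF m])
qed

lemma gen_q_q_not_dvd:
  assumes "i \<in> {1..n}" "j \<in> {1..n}" "i \<noteq> j" "1 \<le> q" "a \<in> Poly_Mapping.keys (gen m n q i (i - 1))"
  shows "\<not> monom_dvd (lead_monom (gen m n q j (j - 1))) a"
proof (rule not_monom_dvdI[of _ j])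
  have "Poly_Mapping.lookup a j \<le> (if j \<in> {i..n} then m * (i - 1) + q else 0)"
    using keys_gen_bound[OF m assms(5)] .
  also have "\<dots> < m * (j - 1) + q"
  proof (cases "j \<in> {i..n}")
    case True
    then have "i - 1 < j - 1" using assms by auto
    then have "m * (i - 1) < m * (j - 1)" using m by simp
    then show ?thesis using True by simp
  next
    case False
    then show ?thesis using assms(4) by (simp only: if_False)
  qed
  finally show "Poly_Mapping.lookup a j < Poly_Mapping.lookup (lead_monom (gen m n q j (j - 1))) j"
    using assms by (simp add: lookup_lead_gen[OF m])
qed

text \<open>
  For \<open>i \<noteq> j\<close> the exponents of \<open>x\<^sub>j\<close> decide. For \<open>i = j\<close> the exponent of \<open>x\<^sub>i\<close> is a multiple of \<open>m\<close> above
  \<open>m (i - 1)\<close> only for \<open>x\<^sub>i\<^bsup>m i\<^esup>\<close>, which does not contain \<open>x\<^bsub>i+1\<^esub>\<close>; this is where \<open>i < n\<close> enters.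
\<close>

lemma gen_q_0_not_dvd:
  assumes i: "i \<in> {1..n-1}" and j: "j \<in> {1..n}" and q: "1 \<le> q"
    and a: "a \<in> Poly_Mapping.keys (gen m n 0 i i)"
  shows "\<not> monom_dvd (lead_monom (gen m n q j (j - 1))) a"
proof (cases "i = j")
  case False
  show ?thesis
  proof (rule not_monom_dvdI[of _ j])
    have "Poly_Mapping.lookup a j \<le> (if j \<in> {i..n} then m * i + 0 else 0)"
      using keys_gen_bound[OF m a] .
    also have "\<dots> < m * (j - 1) + q"
    proof (cases "j \<in> {i..n}")
      case True
      then have "i \<le> j - 1" using \<open>i \<noteq> j\<close> by auto
      then have "m * i \<le> m * (j - 1)" by (rule mult_le_mono2)
      then have "m * i < m * (j - 1) + q" using q by linarith
      then show ?thesis using True by (simp only: if_True add_0_right)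
    next
      case False
      then show ?thesis using q by (simp only: if_False)
    qed
    finally show "Poly_Mapping.lookup a j < Poly_Mapping.lookup (lead_monom (gen m n q j (j - 1))) j"
      using j by (simp add: lookup_lead_gen[OF m])
  qed
next
  case True
  obtain M where M: "M \<in> msets i {i..n}" and aM: "a = gen_exp m n 0 i M"
    using a keys_gen[OF m] by blast
  have size: "size M = i" using M by (simp add: msets_def)
  have i_n: "Suc i \<le> n" using i by auto
  show ?thesis
  proof (cases "count M i = i")
    case True
    then have "M = replicate_mset i i" using count_eq_size_imp_replicate[of M i] size by simp
    then have "Poly_Mapping.lookup a (Suc i) = 0" by (simp add: aM lookup_gen_exp)
    then show ?thesis
      using i_n q \<open>i = j\<close> by (intro not_monom_dvdI[of _ "Suc i"]) (simp add: lookup_lead_gen[OF m])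
  next
    case False
    then have "count M i \<le> i - 1" using count_le_size[of M i] size by linarith
    then have "m * count M i \<le> m * (i - 1)" by (rule mult_le_mono2)
    then have "m * count M i < m * (i - 1) + q" using q by linarith
    moreover have "Poly_Mapping.lookup a i = m * count M i" using i_n by (simp add: aM lookup_gen_exp)
    ultimately have "Poly_Mapping.lookup a i < m * (i - 1) + q" by (simp only:)
    then show ?thesis
      using i_n \<open>i = j\<close> by (intro not_monom_dvdI[of _ i]) (simp add: lookup_lead_gen[OF m])
  qed
qed

lemma lead_gen_0_dvdI:
  assumes "j \<in> {1..n}" "m * j \<le> Poly_Mapping.lookup a j"
  shows "monom_dvd (lead_monom (gen m n 0 j j)) a"
  using assms by (simp add: monom_dvd_iff lookup_lead_gen[OF m])

lemma lead_gen_q_dvdI: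
  assumes "j \<in> {1..n}" "m * (j - 1) + q \<le> Poly_Mapping.lookup a j"
    "\<And>i. i \<in> {j<..n} \<Longrightarrow> q \<le> Poly_Mapping.lookup a i"
  shows "monom_dvd (lead_monom (gen m n q j (j - 1))) a"
  using assms by (simp add: monom_dvd_iff lookup_lead_gen[OF m])

lemma gen_0_neq_gen_q:
  assumes "i \<in> {1..n}" "j \<in> {1..n}" "q < m"
  shows "gen m n 0 i i \<noteq> gen m n q j (j - 1)"
proof
  assume eq: "gen m n 0 i i = gen m n q j (j - 1)"
  have "replicate_mset i i \<in> msets i {i..n}" using assms by (simp add: msets_def)
  then have "lead_monom (gen m n 0 i i) \<in> Poly_Mapping.keys (gen m n 0 i i)"
    using assms by (simp add: gen_lead[OF m] keys_gen[OF m])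
  then show False
    using gen_0_q_not_dvd[OF assms(2,1,3)] monom_dvd_refl unfolding eq by metis
qed

end

lemma reduced_groebner_basisI:
  assumes K: "subfield K (class_ring :: complex ring)" and I: "ideal I (mpoly_ring K n)"
    and B: "finite B" "B \<subseteq> I" and monic: "\<And>g. g \<in> B \<Longrightarrow> lead_coef g = 1"
    and dvd: "\<And>f. f \<in> I \<Longrightarrow> f \<noteq> 0 \<Longrightarrow> \<exists>g\<in>B. monom_dvd (lead_monom g) (lead_monom f)"
    and red: "\<And>g h a. g \<in> B \<Longrightarrow> h \<in> B \<Longrightarrow> g \<noteq> h \<Longrightarrow> a \<in> Poly_Mapping.keys h \<Longrightarrow> \<not> monom_dvd (lead_monom g) a"
  shows "reduced_groebner_basis K n I B"
proof -
  have "0 \<notin> B" using monic[of 0] by (auto simp: lead_coef_def)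
  then have "groebner_basis K n I B"
    unfolding groebner_basis_iff[OF K I] using B dvd by simp
  then show ?thesis
    unfolding reduced_groebner_basis_def
    by (intro conjI ballI monic red) auto
qed

theorem theorem5p6:
  fixes K :: "complex set" and m p n :: nat
  assumes "subfield K (class_ring :: complex ring)"
    and "\<forall>z \<in> K. cnj z \<in> K"
    and "\<forall>z. z ^ m = 1 \<longrightarrow> z \<in> K"
    and "m \<ge> 1" and "p \<ge> 1" and "n \<ge> 1" and "p dvd m"
  defines "I \<equiv> invariant_ideal K n (G_group K m p n)"
    and "A \<equiv> \<lambda>N. {complete_hom j {j..n} (\<lambda>i. var i ^ m) | j. j \<in> {1..N}}"
    and "B \<equiv> {complete_hom (j - 1) {j..n} (\<lambda>i. var i ^ m) * (\<Prod>i = j..n. var i) ^ (m div p) | j. j \<in> {1..n}}"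
  shows "(p = 1 \<longrightarrow> (\<forall>\<G>. reduced_groebner_basis K n I \<G> \<longleftrightarrow> \<G> = A n)) \<and>
    (p > 1 \<longrightarrow> A (n - 1) \<inter> B = {} \<and>
      (\<forall>\<G>. reduced_groebner_basis K n I \<G> \<longleftrightarrow> \<G> = A (n - 1) \<union> B))"
proof -
  note K = assms(1) and roots = assms(3) and m = assms(4) and n = assms(6) and p = assms(7)
  let ?q = "m div p"
  have q: "1 \<le> ?q" using div_facts(2)[OF m p] .
  have A: "A N = (\<lambda>j. gen m n 0 j j) ` {1..N}" for N
    by (auto simp: A_def gen_def)
  have B: "B = (\<lambda>j. gen m n ?q j (j - 1)) ` {1..n}"
    by (auto simp: B_def gen_def)
  have I: "ideal I (mpoly_ring K n)"
    unfolding I_def by (rule ideal_invariant_ideal[OF K])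
  have A_I: "A N \<subseteq> I" if "N \<le> n" for N
    unfolding A I_def using that by (auto intro!: gen_0_in_invariant_ideal[OF K m])
  have B_I: "B \<subseteq> I"
    unfolding B I_def by (auto intro!: gen_q_in_invariant_ideal[OF K m p])
  have monic: "lead_coef g = 1" if "g \<in> A n \<union> B" for g
    using that unfolding A B by (auto simp: gen_lead[OF m])
  have A_mono: "A (n - 1) \<subseteq> A n" unfolding A by auto
  have lead: "(\<exists>j\<in>{1..n-1}. m * j \<le> Poly_Mapping.lookup (lead_monom f) j) \<or>
      (\<exists>j\<in>{1..n}. m * (j - 1) + ?q \<le> Poly_Mapping.lookup (lead_monom f) j \<and>
        (\<forall>i\<in>{j<..n}. ?q \<le> Poly_Mapping.lookup (lead_monom f) i))" if "f \<in> I" "f \<noteq> 0" for f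
    using that ideal_mpoly_ringD(1)[OF K I]
    by (intro invariant_ideal_lead_monom[OF K roots m p n]) (auto simp: I_def)
  have dvd_A: "\<exists>g\<in>A N. monom_dvd (lead_monom g) a"
    if "j \<in> {1..N}" "N \<le> n" "m * j \<le> Poly_Mapping.lookup a j" for N j a
    unfolding A using that by (intro bexI[of _ "gen m n 0 j j"] imageI lead_gen_0_dvdI[OF m]) auto
  show ?thesis
  proof (intro conjI impI allI)
    fix G assume p1: "p = 1"
    have "reduced_groebner_basis K n I (A n)"
    proof (rule reduced_groebner_basisI[OF K I])
      show "\<exists>g\<in>A n. monom_dvd (lead_monom g) (lead_monom f)" if f: "f \<in> I" "f \<noteq> 0" for f
      proof -
        have "\<exists>j\<in>{1..n}. m * j \<le> Poly_Mapping.lookup (lead_monom f) j"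
          using lead[OF f]
        proof (elim disjE bexE conjE)
          fix j assume "j \<in> {1..n-1}" "m * j \<le> Poly_Mapping.lookup (lead_monom f) j"
          then show ?thesis by (intro bexI[of _ j]) auto
        next
          fix j assume j: "j \<in> {1..n}" "m * (j - 1) + ?q \<le> Poly_Mapping.lookup (lead_monom f) j"
          \<comment> \<open>As \<open>m div p = m\<close> here, the second alternative is an instance of the first, now also for \<open>j = n\<close>.\<close>
          have "m * (j - 1) + ?q = m * j" using j(1) p1 by (cases j) auto
          then show ?thesis using j by (intro bexI[of _ j]) auto
        qed
        then show ?thesis using dvd_A by blast
      qed
      show "\<not> monom_dvd (lead_monom g) a"
        if "g \<in> A n" "h \<in> A n" "g \<noteq> h" "a \<in> Poly_Mapping.keys h" for g h a
        using that gen_0_0_not_dvd[OF m] unfolding A by blast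
    qed (use A_I[of n] monic in \<open>auto simp: A\<close>)
    then show "reduced_groebner_basis K n I G \<longleftrightarrow> G = A n"
      by (rule reduced_groebner_basis_unique[OF K I])
  next
    assume "p > 1"
    then have qm: "?q < m" using m by (intro div_less_dividend) auto
    show "A (n - 1) \<inter> B = {}"
      unfolding A B using gen_0_neq_gen_q[OF m _ _ qm] by fastforce
    fix G
    have "reduced_groebner_basis K n I (A (n - 1) \<union> B)"
    proof (rule reduced_groebner_basisI[OF K I])
      show "\<exists>g\<in>A (n - 1) \<union> B. monom_dvd (lead_monom g) (lead_monom f)" if f: "f \<in> I" "f \<noteq> 0" for f
        using lead[OF f]
      proof (elim disjE bexE conjE)
        fix j assume "j \<in> {1..n-1}" "m * j \<le> Poly_Mapping.lookup (lead_monom f) j"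
        then show ?thesis using dvd_A[of j "n - 1"] by auto
      next
        fix j assume "j \<in> {1..n}" "m * (j - 1) + ?q \<le> Poly_Mapping.lookup (lead_monom f) j"
          "\<forall>i\<in>{j<..n}. ?q \<le> Poly_Mapping.lookup (lead_monom f) i"
        then show ?thesis
          unfolding B by (intro bexI[of _ "gen m n ?q j (j - 1)"] UnI2 imageI lead_gen_q_dvdI[OF m]) auto
      qed
      show "\<not> monom_dvd (lead_monom g) a"
        if gh: "g \<in> A (n - 1) \<union> B" "h \<in> A (n - 1) \<union> B" "g \<noteq> h" and a: "a \<in> Poly_Mapping.keys h" for g h a
      proof -
        consider j where "j \<in> {1..n-1}" "g = gen m n 0 j j" | j where "j \<in> {1..n}" "g = gen m n ?q j (j - 1)"
          using gh(1) unfolding A B by blast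
        note g_cases = this
        consider i where "i \<in> {1..n-1}" "h = gen m n 0 i i" | i where "i \<in> {1..n}" "h = gen m n ?q i (i - 1)"
          using gh(2) unfolding A B by blast
        then show ?thesis
        proof cases
          case h: (1 i)
          then have i: "i \<in> {1..n}" by auto
          from g_cases show ?thesis
          proof cases
            case (1 j)
            then have "j \<in> {1..n}" "i \<noteq> j" using gh(3) h by auto
            then show ?thesis using gen_0_0_not_dvd[OF m i] a 1 h by blast
          next
            case (2 j)
            then show ?thesis using gen_q_0_not_dvd[OF m h(1) _ q] a h by blast
          qed
        next
          case h: (2 i)
          from g_cases show ?thesis
          proof cases
            case (1 j)
            then have "j \<in> {1..n}" by auto
            then show ?thesis using gen_0_q_not_dvd[OF m h(1) _ qm] a 1 h by blast
          next
            case (2 j)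
            then have "i \<noteq> j" using gh(3) h by auto
            then show ?thesis using gen_q_q_not_dvd[OF m h(1) _ _ q] a 2 h by blast
          qed
        qed
      qed
      show "A (n - 1) \<union> B \<subseteq> I" using A_I[of "n - 1"] B_I by simp
      show "lead_coef g = 1" if "g \<in> A (n - 1) \<union> B" for g
        using monic A_mono that by blast
    qed (simp add: A B)
    then show "reduced_groebner_basis K n I G \<longleftrightarrow> G = A (n - 1) \<union> B"
      by (rule reduced_groebner_basis_unique[OF K I])
  qed
qed

end
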